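(* Let $k$ be a field of characteristic zero and let $S=k[x_1,x_2,x_3,x_4]$ with the standard grading, $S_d$ denoting the space of forms of degree $d$. If $d\in\{5,7\}$, then for every integer $r\geq 1$ there is a nonempty Zariski-open subset $U_{d,r}\subseteq (S_d)^r$ such that every $(F_1,\ldots,F_r)\in U_{d,r}$ satisfies $$\operatorname{HS}_{S/(F_1,\ldots,F_r)}(t)=\left[\frac{(1-t^d)^r}{(1-t)^4}\right]_{+}.$$
   Context: For a homogeneous ideal $I\subseteq S$, $\operatorname{HS}_{S/I}(t)=\sum_{j\ge 0}\dim_k (S/I)_j\,t^j$ is the Hilbert series of $S/I$. For a power series $A(t)=\sum_{j\ge 0}a_jt^j$ with integer coefficients, the positive truncation $[A(t)]_+$ retains the coefficients $a_j$ strictly before the first nonpositive coefficient and sets that coefficient and all later coefficients equal to zero (if there is no nonpositive coefficient, $[A(t)]_+=A(t)$). The space $(S_d)^r$ is a finite-dimensional $k$-vector space, regarded as an affine space via the coefficients of the forms; Zariski-open refers to the Zariski topology on it. *)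

theory Defs
  imports
    "HOL-Library.Poly_Mapping"
    "HOL-Library.Numeral_Type"
    "HOL-Library.FuncSet"
    "HOL-Computational_Algebra.Formal_Power_Series"
    "HOL-Algebra.Embedded_Algebras"
    "HOL-Algebra.QuotRing"
    "HOL-Algebra.Algebraic_Closure_Type"
begin

text \<open>Polynomials are finitely supported coefficient functions on exponent vectors; with the
  convolution product of \<^theory>\<open>HOL-Library.Poly_Mapping\<close> they form a commutative ring.
  The ring \<open>S = k[x\<^sub>1, x\<^sub>2, x\<^sub>3, x\<^sub>4]\<close> is \<open>(4, 'k) mpoly\<close>.\<close>

type_synonym ('v, 'k) mpoly = "('v \<Rightarrow>\<^sub>0 nat) \<Rightarrow>\<^sub>0 'k"

definition const_poly :: "'k \<Rightarrow> ('v, 'k::zero) mpoly" where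
  "const_poly c = Poly_Mapping.single 0 c"

definition mon_degree :: "('v \<Rightarrow>\<^sub>0 nat) \<Rightarrow> nat" where
  "mon_degree m = (\<Sum>v\<in>Poly_Mapping.keys m. Poly_Mapping.lookup m v)"

definition forms :: "nat \<Rightarrow> ('v, 'k::zero) mpoly set" where
  "forms d = {p. \<forall>m\<in>Poly_Mapping.keys p. mon_degree m = d}"

definition eval_mpoly :: "('v \<Rightarrow> 'k) \<Rightarrow> ('v, 'k::comm_semiring_1) mpoly \<Rightarrow> 'k" where
  "eval_mpoly x p = (\<Sum>m\<in>Poly_Mapping.keys p. Poly_Mapping.lookup p m *
     (\<Prod>v\<in>Poly_Mapping.keys m. x v ^ Poly_Mapping.lookup m v))"

definition ideal_of :: "('v, 'k::field) mpoly set \<Rightarrow> ('v, 'k) mpoly set" where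
  "ideal_of A = genideal ring_of_type_algebra A"

definition quotient_map :: "('v, 'k::field) mpoly set \<Rightarrow> ('v, 'k) mpoly \<Rightarrow> ('v, 'k) mpoly set" where
  "quotient_map I p = a_r_coset ring_of_type_algebra I p"

text \<open>\<open>dim\<^sub>k (S/I)\<^sub>j\<close>: the graded piece \<open>(S/I)\<^sub>j\<close> is the image of \<open>S\<^sub>j\<close> in the quotient ring,
  and \<open>k\<close> acts on it through its image in \<open>S/I\<close>. If \<open>I\<close> is the unit ideal then that image
  is not a field, but every graded piece is the zero space, of dimension \<open>0\<close>.\<close>

definition hilbert_function :: "('v, 'k::field) mpoly set \<Rightarrow> nat \<Rightarrow> nat" where
  "hilbert_function I j =
     ring.dim (ring_of_type_algebra Quot I)
       (quotient_map I ` range const_poly) (quotient_map I ` forms j)"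

text \<open>Rational coefficients, so that \<open>/\<close> on power series is available.\<close>

definition hilbert_series :: "('v, 'k::field) mpoly set \<Rightarrow> rat fps" where
  "hilbert_series I = Abs_fps (\<lambda>j. of_nat (hilbert_function I j))"

definition positive_truncation :: "rat fps \<Rightarrow> rat fps" where
  "positive_truncation A =
     Abs_fps (\<lambda>j. if \<forall>i\<le>j. fps_nth A i > 0 then fps_nth A j else 0)"

definition form_tuples :: "nat \<Rightarrow> nat \<Rightarrow> (nat \<Rightarrow> ('v, 'k::zero) mpoly) set" where
  "form_tuples d r = {1..r} \<rightarrow>\<^sub>E forms d"

text \<open>The affine coordinates on \<open>(S\<^sub>d)\<^sup>r\<close>: the one with index \<open>(i, m)\<close> is the coefficient of the
  monomial \<open>m\<close> in the \<open>i\<close>-th form.\<close>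

definition coord_indices :: "nat \<Rightarrow> nat \<Rightarrow> (nat \<times> ('v \<Rightarrow>\<^sub>0 nat)) set" where
  "coord_indices d r = {1..r} \<times> {m. mon_degree m = d}"

definition coords :: "(nat \<Rightarrow> ('v, 'k::zero) mpoly) \<Rightarrow> nat \<times> ('v \<Rightarrow>\<^sub>0 nat) \<Rightarrow> 'k" where
  "coords F = (\<lambda>(i, m). Poly_Mapping.lookup (F i) m)"

definition coord_ring :: "nat \<Rightarrow> nat \<Rightarrow> (nat \<times> ('v \<Rightarrow>\<^sub>0 nat), 'k::zero) mpoly set" where
  "coord_ring d r = {P. \<forall>m\<in>Poly_Mapping.keys P. Poly_Mapping.keys m \<subseteq> coord_indices d r}"

definition zariski_closed ::
    "nat \<Rightarrow> nat \<Rightarrow> (nat \<Rightarrow> ('v, 'k::comm_semiring_1) mpoly) set \<Rightarrow> bool" where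
  "zariski_closed d r Z \<longleftrightarrow>
     (\<exists>\<P>\<subseteq>coord_ring d r. Z = {F \<in> form_tuples d r. \<forall>P\<in>\<P>. eval_mpoly (coords F) P = 0})"

definition zariski_open ::
    "nat \<Rightarrow> nat \<Rightarrow> (nat \<Rightarrow> ('v, 'k::comm_semiring_1) mpoly) set \<Rightarrow> bool" where
  "zariski_open d r U \<longleftrightarrow> U \<subseteq> form_tuples d r \<and> zariski_closed d r (form_tuples d r - U)"

end

theory Submission
  imports Defs "HOL-Library.Code_Binary_Nat"
begin

text \<open>
  Write \<open>I\<close> for the ideal of a tuple \<open>F\<^sub>1, \<dots>, F\<^sub>r\<close> of forms of degree \<open>d\<close>. Its degree \<open>j\<close> part is
  spanned by the products \<open>x\<^sup>a F\<^sub>i\<close> with \<open>|a| = j - d\<close> (\<open>ideal_degree_part\<close>), so the Hilbert function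
  at \<open>j\<close> is \<open>dim S\<^sub>j\<close> minus the rank of a matrix whose entries are coefficients of the \<open>F\<^sub>i\<close>. The
  claim is that generically these ranks are as large as the relations between the \<open>F\<^sub>i\<close> permit.

  \<^bold>\<open>Ranks are generic.\<close> If some tuple reaches rank \<open>n\<close> in degree \<open>j\<close>, then so does every tuple outside
  the zero set of a polynomial, namely the product of the pivots of a Gaussian elimination that
  works for the given tuple (\<open>rank_ge_polyfun_open\<close>). Finitely many such nonempty open conditions hold
  simultaneously somewhere, since \<open>k\<close> is infinite (\<open>generic_conj\<close>). Hence each rank may be exhibited by
  a tuple of its own.

  \<^bold>\<open>Ranks are never too large.\<close> In degrees below \<open>2 d\<close> it is enough that there are only
  \<open>r dim S\<^bsub>j-d\<^esub>\<close> products \<open>x\<^sup>a F\<^sub>i\<close>. For few forms the bound comes from multiplication by the last form: it maps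
  \<open>S/(F\<^sub>1, \<dots>, F\<^sub>r)\<close> shifted by \<open>d\<close> onto the kernel of the projection to \<open>S/(F\<^sub>1, \<dots>, F\<^bsub>r+1\<^esub>)\<close>
  (\<open>hf_exact\<close>). For four forms generating an ideal that is as large as that of \<open>x\<^sub>i\<^sup>d\<close>, the resulting chain
  of inequalities begins and ends with known values, so all of them are equalities
  (\<open>chain_of_inequalities_exact\<close>). This settles \<open>r \<le> 4\<close> in all degrees at once, and one further
  application gives the bound for \<open>r = 5\<close>.

  \<^bold>\<open>Few ranks suffice.\<close> For \<open>r \<ge> 5\<close> let \<open>J\<close> be the degree of the first nonpositive coefficient. Below \<open>J\<close> the
  products \<open>x\<^sup>a F\<^sub>i\<close> have to be independent (up to Koszul relations if \<open>r = 5\<close>), in degree \<open>J\<close> they have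
  to span. Independence is inherited by lower degrees and by fewer forms
  (\<open>attained_injective_descends\<close>), spanning by higher degrees and by more forms
  (\<open>hf_eq_0_Suc\<close>, \<open>attained_more_forms\<close>). What remains is one tuple for each of nine pairs \<open>(r, j)\<close> if
  \<open>d = 5\<close> and fifteen pairs if \<open>d = 7\<close>.

  \<^bold>\<open>Explicit tuples.\<close> They consist of \<open>x\<^sub>1\<^sup>d, \<dots>, x\<^sub>4\<^sup>d\<close> and of sums of a few monomials. The powers
  account for all monomials outside the box of exponents below \<open>d\<close>. The other forms are homogeneous
  for a second grading by \<open>\<int>/m\<close>, which splits the matrix on the box into small blocks. The blocks
  have entries \<open>0\<close> and \<open>1\<close>, and their ranks over \<open>k\<close> are at least the ranks modulo \<open>2\<close>, which are
  found by evaluating an elimination procedure (\<open>parity_rank_sound\<close>, \<open>attained_from_blocks\<close>).\<close>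

section \<open>Monomials and forms\<close>

lemma mon_degree_superset:
  assumes "finite A" "Poly_Mapping.keys m \<subseteq> A"
  shows "mon_degree m = (\<Sum>v\<in>A. Poly_Mapping.lookup m v)"
  unfolding mon_degree_def
  by (rule sum.mono_neutral_left) (use assms in \<open>auto simp: in_keys_iff\<close>)

lemma mon_degree_add: "mon_degree (a + b) = mon_degree a + mon_degree b"
proof -
  let ?A = "Poly_Mapping.keys a \<union> Poly_Mapping.keys b"
  have "Poly_Mapping.keys (a + b) \<subseteq> ?A" by (rule keys_add)
  then show ?thesis
    by (simp add: mon_degree_superset[of ?A] lookup_add sum.distrib)
qed

lemma mon_degree_0 [simp]: "mon_degree 0 = 0"
  by (simp add: mon_degree_def)

lemma mon_degree_single [simp]: "mon_degree (Poly_Mapping.single v n) = n"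
  by (simp add: mon_degree_def)

text \<open>The quantifier says that \<open>a\<close> divides \<open>m\<close>; subtraction of exponent vectors truncates.\<close>

lemma lookup_single_mult:
  fixes p :: "('v::type, 'k::comm_semiring_1) mpoly"
  shows "Poly_Mapping.lookup (Poly_Mapping.single a c * p) m =
    (if \<exists>b. m = a + b then c * Poly_Mapping.lookup p (m - a) else 0)"
proof -
  have "Poly_Mapping.lookup (Poly_Mapping.single a c * p) m =
    (\<Sum>l. (c when a = l) * (\<Sum>q. Poly_Mapping.lookup p q when m = l + q))"
    by (simp add: lookup_mult lookup_single)
  also have "\<dots> = (\<Sum>l. (c * (\<Sum>q. Poly_Mapping.lookup p q when m = l + q) when a = l))"
    by (simp add: when_mult)
  also have "\<dots> = c * (\<Sum>q. Poly_Mapping.lookup p q when m = a + q)"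
    by simp
  also have "(\<Sum>q. Poly_Mapping.lookup p q when m = a + q) =
      (if \<exists>b. m = a + b then Poly_Mapping.lookup p (m - a) else 0)"
  proof (cases "\<exists>b. m = a + b")
    case True
    then obtain b where b: "m = a + b" by blast
    have "(m = a + q) = (q = b)" for q using b by auto
    then show ?thesis using b by simp
  next
    case False then show ?thesis by (auto simp: when_def)
  qed
  finally show ?thesis by auto
qed

lemma lookup_const_poly_mult [simp]:
  fixes p :: "('v::type, 'k::comm_semiring_1) mpoly"
  shows "Poly_Mapping.lookup (const_poly c * p) m = c * Poly_Mapping.lookup p m"
  by (simp add: const_poly_def lookup_single_mult)

interpretation mp: vector_space "\<lambda>(c::'k::field) (p::('v, 'k) mpoly). const_poly c * p"
proof
  fix a b :: 'k and x y :: "('v, 'k) mpoly"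
  show "const_poly a * (x + y) = const_poly a * x + const_poly a * y"
    by (rule distrib_left)
  show "const_poly (a + b) * x = const_poly a * x + const_poly b * x"
    by (simp add: const_poly_def single_add distrib_right)
  have "const_poly a * const_poly b = (const_poly (a * b) :: ('v, 'k) mpoly)"
    by (simp add: const_poly_def mult_single)
  then show "const_poly a * (const_poly b * x) = const_poly (a * b) * x"
    by (metis mult.assoc)
  show "const_poly 1 * x = x"
    by (simp add: const_poly_def)
qed

abbreviation xmon :: "('v \<Rightarrow>\<^sub>0 nat) \<Rightarrow> ('v, 'k::comm_semiring_1) mpoly" where
  "xmon a \<equiv> Poly_Mapping.single a 1"

lemma poly_sum_monoms:
  fixes p :: "('v, 'k::field) mpoly"
  shows "p = (\<Sum>a\<in>Poly_Mapping.keys p. const_poly (Poly_Mapping.lookup p a) * xmon a)"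
proof (rule poly_mapping_eqI)
  fix m
  have "Poly_Mapping.lookup (\<Sum>a\<in>Poly_Mapping.keys p. const_poly (Poly_Mapping.lookup p a) * xmon
      a) m
    = (\<Sum>a\<in>Poly_Mapping.keys p. if a = m then Poly_Mapping.lookup p a else 0)"
    unfolding lookup_sum lookup_const_poly_mult by (intro sum.cong) (auto simp: lookup_single
        when_def)
  then show "Poly_Mapping.lookup p m = Poly_Mapping.lookup (\<Sum>a\<in>Poly_Mapping.keys p. const_poly
      (Poly_Mapping.lookup p a) * xmon a) m"
    by (simp add: in_keys_iff)
qed

lemma forms_eq_span: "forms d = mp.span (xmon ` {a. mon_degree a = d})"
proof
  show "(forms d :: ('a, 'b) mpoly set) \<subseteq> mp.span (xmon ` {a. mon_degree a = d})"
  proof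
    fix p :: "('a, 'b) mpoly" assume p: "p \<in> forms d"
    have "(\<Sum>a\<in>Poly_Mapping.keys p. const_poly (Poly_Mapping.lookup p a) * xmon a) \<in> mp.span (xmon
        ` {a. mon_degree a = d})"
      using p by (intro mp.span_sum mp.span_scale mp.span_base) (auto simp: forms_def)
    then show "p \<in> mp.span (xmon ` {a. mon_degree a = d})"
      using poly_sum_monoms[of p] by simp
  qed
  have "mp.subspace (forms d :: ('a,'b) mpoly set)"
    unfolding mp.subspace_def by (auto simp: forms_def in_keys_iff lookup_add)
  moreover have "xmon ` {a. mon_degree a = d} \<subseteq> (forms d :: ('a,'b) mpoly set)"
    by (auto simp: forms_def)
  ultimately show "mp.span (xmon ` {a. mon_degree a = d}) \<subseteq> (forms d :: ('a,'b) mpoly set)"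
    by (simp add: mp.span_minimal)
qed

lemma subspace_forms: "mp.subspace (forms d)"
  by (simp add: forms_eq_span)

lemma finite_monomials: "finite {a :: 'v::finite \<Rightarrow>\<^sub>0 nat. mon_degree a = d}"
proof -
  have "Poly_Mapping.lookup ` {a :: 'v \<Rightarrow>\<^sub>0 nat. mon_degree a = d} \<subseteq> PiE UNIV (\<lambda>_. {..d})"
  proof (clarsimp simp: PiE_def)
    fix a :: "'v \<Rightarrow>\<^sub>0 nat" and v
    show "Poly_Mapping.lookup a v \<le> mon_degree a"
      by (simp add: mon_degree_superset[of UNIV] member_le_sum)
  qed
  then have "finite (Poly_Mapping.lookup ` {a :: 'v \<Rightarrow>\<^sub>0 nat. mon_degree a = d})"
    by (rule finite_subset) (simp add: finite_PiE)
  then show ?thesis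
    by (rule finite_imageD) (simp add: inj_on_def poly_mapping_eqI)
qed

text \<open>The tool for all independence proofs: a polynomial with a nonzero coefficient at a monomial
  that does not occur in \<open>S\<close> is not in the span of \<open>S\<close>.\<close>

lemma span_lookup_eq_0:
  assumes "\<And>p. p \<in> S \<Longrightarrow> Poly_Mapping.lookup p m = 0" "q \<in> mp.span S"
  shows "Poly_Mapping.lookup q m = 0"
  using assms(2)
  by (induction rule: mp.span_induct_alt) (auto simp: lookup_add assms(1))

lemma inj_monom: "inj (xmon :: ('v \<Rightarrow>\<^sub>0 nat) \<Rightarrow> ('v, 'k::field) mpoly)"
proof (rule injI)
  fix a b :: "'v \<Rightarrow>\<^sub>0 nat" assume "(xmon a :: ('v, 'k) mpoly) = xmon b"
  then have "Poly_Mapping.keys (xmon a :: ('v, 'k) mpoly) = Poly_Mapping.keys (xmon b :: ('v, 'k)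
      mpoly)" by simp
  then show "a = b" by simp
qed

lemma independent_monoms: "mp.independent (xmon ` A :: ('a, 'b::field) mpoly set)"
proof
  assume "mp.dependent (xmon ` A :: ('a, 'b) mpoly set)"
  then obtain a where a: "a \<in> A" "(xmon a :: ('a, 'b) mpoly) \<in> mp.span (xmon ` A - {xmon a})"
    unfolding mp.dependent_def by auto
  have "Poly_Mapping.lookup (xmon a :: ('a, 'b) mpoly) a = 0"
    by (rule span_lookup_eq_0[OF _ a(2)]) (auto simp: lookup_single when_def)
  then show False by simp
qed

section \<open>Lower bounds for ranks\<close>

text \<open>Lower bounds on ranks are expressed by independent sets rather than by \<open>mp.dim\<close>, which is zero by
  convention on subsets with a span of infinite dimension.\<close>

definition rank_ge :: "('v, 'k::field) mpoly set \<Rightarrow> nat \<Rightarrow> bool" where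
  "rank_ge S n \<longleftrightarrow> (\<exists>B. finite B \<and> mp.independent B \<and> B \<subseteq> mp.span S \<and> card B = n)"

lemma rank_ge_mono: "rank_ge S n \<Longrightarrow> S \<subseteq> mp.span T \<Longrightarrow> rank_ge T n"
  unfolding rank_ge_def using mp.span_minimal[of S "mp.span T"] by blast

lemma rank_ge_less: assumes "rank_ge S n" "m \<le> n" shows "rank_ge S m"
proof -
  obtain B where B: "finite B" "mp.independent B" "B \<subseteq> mp.span S" "card B = n"
    using assms by (auto simp: rank_ge_def)
  obtain C where "C \<subseteq> B" "card C = m"
    using B assms(2) obtain_subset_with_card_n by metis
  then have "finite C \<and> mp.independent C \<and> C \<subseteq> mp.span S \<and> card C = m"
    using B finite_subset mp.independent_mono by blast
  then show ?thesis unfolding rank_ge_def by blast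
qed

lemma rank_ge_insert:
  assumes "rank_ge S n" "v \<notin> mp.span S"
  shows "rank_ge (insert v S) (Suc n)"
proof -
  obtain B where B: "finite B" "mp.independent B" "B \<subseteq> mp.span S" "card B = n"
    using assms by (auto simp: rank_ge_def)
  have "v \<notin> mp.span B"
    using assms(2) mp.span_minimal[OF B(3)] by auto
  moreover have "v \<notin> B" using B(3) assms(2) by auto
  moreover have "insert v B \<subseteq> mp.span (insert v S)"
    using B(3) mp.span_mono[of S "insert v S"] by (auto intro: mp.span_base)
  ultimately have "finite (insert v B) \<and> mp.independent (insert v B) \<and>
    insert v B \<subseteq> mp.span (insert v S) \<and> card (insert v B) = Suc n"
    using B mp.independent_insertI by auto
  then show ?thesis unfolding rank_ge_def by blast
qed

lemma rank_ge_monoms: "finite A \<Longrightarrow> rank_ge (xmon ` A) (card A)"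
  unfolding rank_ge_def
  by (intro exI[of _ "xmon ` A"]) (auto simp: independent_monoms card_image inj_on_subset[OF
      inj_monom] intro: mp.span_base)

lemma rank_ge_dim: assumes "finite T" "S \<subseteq> mp.span T" "rank_ge S n" shows "n \<le> mp.dim S"
proof -
  obtain B where B: "finite B" "mp.independent B" "B \<subseteq> mp.span S" "card B = n"
    using assms by (auto simp: rank_ge_def)
  obtain C where C: "C \<subseteq> S" "mp.independent C" "S \<subseteq> mp.span C" "card C = mp.dim S"
    by (rule mp.basis_exists)
  have "finite C"
    using mp.independent_span_bound[OF assms(1) C(2)] C(1) assms(2) by auto
  moreover have "B \<subseteq> mp.span C"
    using B(3) mp.span_minimal[OF C(3)] by auto
  ultimately show ?thesis
    using mp.independent_span_bound[of C B] B C by auto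
qed

lemma rank_ge_dim_self: assumes "finite T" "S \<subseteq> mp.span T" shows "rank_ge S (mp.dim S)"
proof -
  obtain C where C: "C \<subseteq> S" "mp.independent C" "S \<subseteq> mp.span C" "card C = mp.dim S"
    by (rule mp.basis_exists)
  have "finite C"
    using mp.independent_span_bound[OF assms(1) C(2)] C(1) assms(2) by auto
  moreover have "C \<subseteq> mp.span S"
    using C(1) mp.span_superset by blast
  ultimately show ?thesis unfolding rank_ge_def using C(2,4) by blast
qed

lemma dim_mono_finite:
  assumes "finite T" "S \<subseteq> mp.span T"
  shows "mp.dim S \<le> mp.dim T"
  using rank_ge_dim[OF assms(1) mp.span_superset rank_ge_mono[OF rank_ge_dim_self[OF assms]
      assms(2)]] .

section \<open>Ideals and the Hilbert function\<close>

abbreviation poly_ring :: "('v, 'k::field) mpoly ring" where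
  "poly_ring \<equiv> ring_of_type_algebra"

lemma poly_ring_simps [simp]:
  "carrier poly_ring = UNIV"
  "x \<otimes>\<^bsub>poly_ring\<^esub> y = x * y"
  "\<one>\<^bsub>poly_ring\<^esub> = 1"
  "\<zero>\<^bsub>poly_ring\<^esub> = 0"
  "x \<oplus>\<^bsub>poly_ring\<^esub> y = x + y"
  by (simp_all add: ring_of_type_algebra_def)

lemma cring_poly_ring: "cring poly_ring"
  by (rule cring_from_type_algebra)

lemma ring_poly_ring: "ring poly_ring"
  by (rule ring_from_type_algebra)

lemma poly_ring_a_inv [simp]: "\<ominus>\<^bsub>poly_ring\<^esub> x = - x"
proof -
  interpret ring poly_ring by (rule ring_poly_ring)
  show ?thesis by (rule minus_equality) simp_all
qed

lemma ideal_poly_ringI: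
  assumes "0 \<in> I" "\<And>p q. p \<in> I \<Longrightarrow> q \<in> I \<Longrightarrow> p + q \<in> I" "\<And>p q. p \<in> I \<Longrightarrow> q * p \<in> I"
  shows "ideal I poly_ring"
proof (rule idealI)
  have neg: "- p \<in> I" if "p \<in> I" for p
    using assms(3)[OF that, of "-1"] by simp
  show "subgroup I (add_monoid poly_ring)"
  proof
    show "I \<subseteq> carrier (add_monoid poly_ring)" by simp
    show "x \<otimes>\<^bsub>add_monoid poly_ring\<^esub> y \<in> I" if "x \<in> I" "y \<in> I" for x y
      using assms(2) that by simp
    show "\<one>\<^bsub>add_monoid poly_ring\<^esub> \<in> I" using assms(1) by simp
    show "inv\<^bsub>add_monoid poly_ring\<^esub> x \<in> I" if "x \<in> I" for x
    proof -
      have "inv\<^bsub>add_monoid poly_ring\<^esub> x = \<ominus>\<^bsub>poly_ring\<^esub> x" by (simp only: a_inv_def)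
      then show ?thesis using neg[OF that] by (simp only: poly_ring_a_inv)
    qed
  qed
qed (use assms in \<open>auto simp: ring_poly_ring mult.commute\<close>)

lemma ideal_poly_ringD:
  assumes "ideal I poly_ring"
  shows "0 \<in> I" "\<And>p q. p \<in> I \<Longrightarrow> q \<in> I \<Longrightarrow> p + q \<in> I" "\<And>p q. p \<in> I \<Longrightarrow> q * p \<in> I"
    "\<And>p. p \<in> I \<Longrightarrow> - p \<in> I"
proof -
  have add: "additive_subgroup I poly_ring" using assms by (rule ideal.axioms)
  show "0 \<in> I" using additive_subgroup.zero_closed[OF add] by simp
  show "p + q \<in> I" if "p \<in> I" "q \<in> I" for p q
    using additive_subgroup.a_closed[OF add that] by simp
  show m: "q * p \<in> I" if "p \<in> I" for p q
    using ideal.I_l_closed[OF assms that, of q] by simp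
  show "- p \<in> I" if "p \<in> I" for p using m[OF that, of "-1"] by simp
qed

lemma ideal_of_image:
  fixes F :: "nat \<Rightarrow> ('v, 'k::field) mpoly"
  shows "ideal_of (F ` {1..r}) = {\<Sum>i\<in>{1..r}. g i * F i | g. True}" (is "_ = ?J")
proof
  interpret ring "poly_ring :: ('v, 'k) mpoly ring" by (rule ring_poly_ring)
  have J: "ideal ?J poly_ring"
  proof (rule ideal_poly_ringI)
    show "0 \<in> ?J" by (intro CollectI exI[of _ "\<lambda>_. 0"]) simp
    show "p + q \<in> ?J" if pq: "p \<in> ?J" "q \<in> ?J" for p q
    proof -
      from pq obtain g h where "p = (\<Sum>i\<in>{1..r}. g i * F i)" "q = (\<Sum>i\<in>{1..r}. h i * F i)" by auto
      then show ?thesis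
        by (intro CollectI exI[of _ "\<lambda>i. g i + h i"]) (simp add: sum.distrib distrib_right)
    qed
    show "q * p \<in> ?J" if p: "p \<in> ?J" for p q
    proof -
      from p obtain g where "p = (\<Sum>i\<in>{1..r}. g i * F i)" by auto
      then show ?thesis
        by (intro CollectI exI[of _ "\<lambda>i. q * g i"]) (simp add: sum_distrib_left mult.assoc)
    qed
  qed
  have "F i \<in> ?J" if "i \<in> {1..r}" for i
    using that by (intro CollectI exI[of _ "\<lambda>k. if k = i then 1 else 0"])
      (simp add: if_distrib[of "\<lambda>x. x * _"] cong: if_cong)
  then show "ideal_of (F ` {1..r}) \<subseteq> ?J"
    unfolding ideal_of_def by (intro genideal_minimal J) auto
  have I: "ideal (ideal_of (F ` {1..r})) poly_ring"
    unfolding ideal_of_def by (rule genideal_ideal) simp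
  note D = ideal_poly_ringD[OF I]
  have F: "F i \<in> ideal_of (F ` {1..r})" if "i \<in> {1..r}" for i
    using genideal_self[of "F ` {1..r}"] that unfolding ideal_of_def by auto
  have "(\<Sum>i\<in>A. g i * F i) \<in> ideal_of (F ` {1..r})" if "finite A" "A \<subseteq> {1..r}" for g A
    using that
  proof (induction A rule: finite_induct)
    case empty
    then show ?case by (simp only: sum.empty D(1))
  next
    case (insert x A)
    then have "g x * F x + (\<Sum>i\<in>A. g i * F i) \<in> ideal_of (F ` {1..r})"
      by (intro D(2)[OF D(3)[OF F]]) simp_all
    then show ?case by (simp only: sum.insert[OF insert(1,2)])
  qed
  then show "?J \<subseteq> ideal_of (F ` {1..r})" by auto
qed

lemma ideal_ideal_of: "ideal (ideal_of A) poly_ring"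
proof -
  interpret ring poly_ring by (rule ring_poly_ring)
  show ?thesis unfolding ideal_of_def by (rule genideal_ideal) simp
qed

lemma subfield_constants: "subfield (range const_poly) (poly_ring :: ('v, 'k::field) mpoly ring)"
proof -
  interpret cring "poly_ring :: ('v, 'k) mpoly ring" by (rule cring_poly_ring)
  have add: "const_poly a + const_poly b = (const_poly (a + b) :: ('v, 'k) mpoly)" for a b
    by (simp add: const_poly_def single_add)
  have mul: "const_poly a * const_poly b = (const_poly (a * b) :: ('v, 'k) mpoly)" for a b
    by (simp add: const_poly_def mult_single)
  have one: "1 = (const_poly 1 :: ('v, 'k) mpoly)" by (simp add: const_poly_def)
  have zero: "0 = (const_poly 0 :: ('v, 'k) mpoly)" by (simp add: const_poly_def)
  have neg: "- const_poly a = (const_poly (- a) :: ('v, 'k) mpoly)" for a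
    by (simp add: const_poly_def single_uminus)
  have inj: "const_poly a = (0 :: ('v, 'k) mpoly) \<longleftrightarrow> a = 0" for a
    by (metis const_poly_def lookup_single_eq lookup_zero single_zero)
  have sub: "subring (range const_poly) (poly_ring :: ('v, 'k) mpoly ring)"
    by (rule subringI) (auto simp: add mul neg one)
  have "subcring (range const_poly) (poly_ring :: ('v, 'k) mpoly ring)"
    by (rule subcringI[OF sub]) (simp add: mult.commute)
  then show ?thesis
  proof (rule subfieldI)
    show "Units ((poly_ring :: ('v, 'k) mpoly ring)\<lparr>carrier := range const_poly\<rparr>) = range
        const_poly - {\<zero>\<^bsub>poly_ring\<^esub>}"
    proof (intro equalityI subsetI)
      fix x assume "x \<in> Units ((poly_ring :: ('v, 'k) mpoly ring)\<lparr>carrier := range const_poly\<rparr>)"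
      then show "x \<in> range const_poly - {\<zero>\<^bsub>poly_ring\<^esub>}"
        by (auto simp: Units_def)
    next
      fix x :: "('v, 'k) mpoly" assume "x \<in> range const_poly - {\<zero>\<^bsub>poly_ring\<^esub>}"
      then obtain c where c: "x = const_poly c" "c \<noteq> 0" by (auto simp: inj)
      have "const_poly (inverse c) * x = 1" "x * const_poly (inverse c) = 1"
        using c by (simp_all add: mul flip: one)
      then show "x \<in> Units (poly_ring\<lparr>carrier := range const_poly\<rparr>)"
        using c(1) unfolding Units_def by auto
    qed
  qed
qed

lemma quotient_map_eq_iff:
  assumes "ideal I poly_ring"
  shows "quotient_map I p = quotient_map I q \<longleftrightarrow> p - q \<in> I"
proof -
  interpret ideal I poly_ring by fact
  have "quotient_map I p = quotient_map I q \<longleftrightarrow> p \<in> quotient_map I q"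
    unfolding quotient_map_def
    using a_repr_independence'[of p q] a_repr_independenceD[of p q] by auto
  also have "\<dots> \<longleftrightarrow> p - q \<in> I"
    unfolding quotient_map_def using a_rcos_module_minus[OF ring_poly_ring, of q p]
    by (simp add: a_minus_def)
  finally show ?thesis .
qed

text \<open>The graded piece of the quotient is \<open>S\<^sub>j / (I \<inter> S\<^sub>j)\<close>. A basis of \<open>I \<inter> S\<^sub>j\<close> is extended to one of
  \<open>S\<^sub>j\<close>, and the images of the added elements are adjoined one at a time, as in the inductive
  definition of the dimension over a subfield. That the constants form a subfield of the quotient
  needs a proper ideal.\<close>

lemma hilbert_function_eq:
  fixes I :: "('v::finite, 'k::field) mpoly set"
  assumes I: "ideal I poly_ring" and one: "1 \<notin> I"
  shows "hilbert_function I j + mp.dim (I \<inter> forms j) = card {a :: 'v \<Rightarrow>\<^sub>0 nat. mon_degree a = j}"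
proof -
  interpret ideal I poly_ring by fact
  let ?Q = "poly_ring Quot I" and ?\<pi> = "quotient_map I"
  let ?K = "?\<pi> ` range const_poly"
  interpret Q: ring ?Q by (rule quotient_is_ring)
  have hom: "ring_hom_ring poly_ring ?Q ?\<pi>"
    unfolding quotient_map_def by (rule rcos_ring_hom_ring)
  then interpret \<pi>: ring_hom_ring poly_ring ?Q ?\<pi> .
  have \<pi>_add: "?\<pi> (p + q) = ?\<pi> p \<oplus>\<^bsub>?Q\<^esub> ?\<pi> q" for p q
    using \<pi>.hom_add[of p q] by simp
  have \<pi>_mult: "?\<pi> (p * q) = ?\<pi> p \<otimes>\<^bsub>?Q\<^esub> ?\<pi> q" for p q
    using \<pi>.hom_mult[of p q] by simp
  have \<pi>_0: "?\<pi> 0 = \<zero>\<^bsub>?Q\<^esub>" using \<pi>.hom_zero by simp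
  have \<pi>_1: "?\<pi> 1 = \<one>\<^bsub>?Q\<^esub>" using \<pi>.hom_one by simp
  have "\<one>\<^bsub>?Q\<^esub> \<noteq> \<zero>\<^bsub>?Q\<^esub>"
    using one quotient_map_eq_iff[OF I, of 1 0] by (simp flip: \<pi>_0 \<pi>_1)
  then have K: "subfield ?K ?Q"
    using \<pi>.img_is_subfield(2)[OF subfield_constants] by simp
  note D = ideal_poly_ringD[OF I]
  have subI: "mp.subspace I" unfolding mp.subspace_def using D by auto
  let ?M = "xmon ` {a :: 'v \<Rightarrow>\<^sub>0 nat. mon_degree a = j} :: ('v, 'k) mpoly set"
  have finM: "finite ?M" by (rule finite_imageI[OF finite_monomials])
  obtain B0 where B0: "B0 \<subseteq> I \<inter> forms j" "mp.independent B0" "I \<inter> forms j \<subseteq> mp.span B0"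
      "card B0 = mp.dim (I \<inter> forms j)"
    by (rule mp.basis_exists)
  obtain B where B: "B0 \<subseteq> B" "B \<subseteq> forms j" "mp.independent B" "forms j \<subseteq> mp.span B"
    using mp.maximal_independent_subset_extend[of B0 "forms j"] B0 by auto
  have finB: "finite B"
    using mp.independent_span_bound[OF finM B(3)] B(2) forms_eq_span by blast
  have cardB: "card B = card {a :: 'v \<Rightarrow>\<^sub>0 nat. mon_degree a = j}"
  proof -
    have "card B = mp.dim (forms j :: ('v, 'k) mpoly set)"
      using mp.basis_card_eq_dim[OF B(2,4,3)] .
    also have "\<dots> = card ?M"
      unfolding forms_eq_span by (rule mp.dim_span_eq_card_independent[OF independent_monoms])
    also have "\<dots> = card {a :: 'v \<Rightarrow>\<^sub>0 nat. mon_degree a = j}"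
      by (rule card_image) (rule inj_on_subset[OF inj_monom], simp)
    finally show ?thesis .
  qed
  have spB: "mp.span C \<subseteq> forms j" if "C \<subseteq> B" for C
    using mp.span_minimal[of C "forms j"] that B(2) subspace_forms by auto
  \<comment> \<open>Each further basis element raises the dimension of the image by one: otherwise it would be
     congruent modulo \<open>I\<close> to an element of the span, and the difference would lie in the span of
     \<open>B0\<close>.\<close>
  have ind: "Q.dimension (card C) ?K (?\<pi> ` mp.span (B0 \<union> C))" if "finite C" "C \<subseteq> B - B0" for C
    using that
  proof (induction C rule: finite_induct)
    case empty
    have "?\<pi> ` mp.span B0 = {\<zero>\<^bsub>?Q\<^esub>}"
    proof -
      have "p \<in> I" if "p \<in> mp.span B0" for p
        using that mp.span_minimal[OF _ subI, of B0] B0(1) by auto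
      then have "?\<pi> p = ?\<pi> 0" if "p \<in> mp.span B0" for p
        using quotient_map_eq_iff[OF I, of p 0] that by simp
      then show ?thesis using mp.span_zero[of B0] \<pi>_0 by force
    qed
    then show ?case using Q.zero_dim by simp
  next
    case (insert c C)
    have c: "c \<notin> mp.span (B0 \<union> C)"
    proof
      assume a: "c \<in> mp.span (B0 \<union> C)"
      have "B0 \<union> C \<subseteq> B - {c}" using insert B(1) by auto
      then have "c \<in> mp.span (B - {c})" using a mp.span_mono by blast
      then show False using B(3) insert(4) unfolding mp.dependent_def by blast
    qed
    have "?\<pi> c \<notin> ?\<pi> ` mp.span (B0 \<union> C)"
    proof
      assume "?\<pi> c \<in> ?\<pi> ` mp.span (B0 \<union> C)"
      then obtain s where s: "s \<in> mp.span (B0 \<union> C)" "c - s \<in> I"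
        using quotient_map_eq_iff[OF I] by auto
      have "c - s \<in> forms j"
        using mp.subspace_diff[OF subspace_forms] s(1) spB[of "B0 \<union> C"] insert B by blast
      then have "c - s \<in> mp.span (B0 \<union> C)"
        using s(2) B0(3) mp.span_mono[of B0 "B0 \<union> C"] by blast
      then have "(c - s) + s \<in> mp.span (B0 \<union> C)" using s(1) mp.span_add by blast
      then show False using c by simp
    qed
    then have "Q.dimension (Suc (card C)) ?K (Q.line_extension ?K (?\<pi> c) (?\<pi> ` mp.span (B0 \<union> C)))"
      using insert by (intro Q.Suc_dim) auto
    also have "Q.line_extension ?K (?\<pi> c) (?\<pi> ` mp.span (B0 \<union> C)) = ?\<pi> ` mp.span (B0 \<union> insert c C)"
    proof (intro equalityI subsetI)
      fix u assume "u \<in> Q.line_extension ?K (?\<pi> c) (?\<pi> ` mp.span (B0 \<union> C))"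
      then obtain k s where s: "s \<in> mp.span (B0 \<union> C)" "u = ?\<pi> (const_poly k * c + s)"
        unfolding Q.line_extension_mem_iff by (auto simp: \<pi>_add \<pi>_mult)
      have "s \<in> mp.span (B0 \<union> insert c C)" using s(1) mp.span_mono[of "B0 \<union> C" "B0 \<union> insert c C"]
          by auto
      then have "const_poly k * c + s \<in> mp.span (B0 \<union> insert c C)"
        by (intro mp.span_add mp.span_scale) (auto intro: mp.span_base)
      then show "u \<in> ?\<pi> ` mp.span (B0 \<union> insert c C)" using s by blast
    next
      fix u assume "u \<in> ?\<pi> ` mp.span (B0 \<union> insert c C)"
      then obtain p where p: "p \<in> mp.span (insert c (B0 \<union> C))" "u = ?\<pi> p" by auto
      then obtain k where k: "p - const_poly k * c \<in> mp.span (B0 \<union> C)"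
        unfolding mp.span_insert by auto
      have "u = ?\<pi> (const_poly k) \<otimes>\<^bsub>?Q\<^esub> ?\<pi> c \<oplus>\<^bsub>?Q\<^esub> ?\<pi> (p - const_poly k * c)"
        using p(2) by (simp flip: \<pi>_add \<pi>_mult)
      then show "u \<in> Q.line_extension ?K (?\<pi> c) (?\<pi> ` mp.span (B0 \<union> C))"
        unfolding Q.line_extension_mem_iff using k by blast
    qed
    finally show ?case using insert by simp
  qed
  have "B0 \<union> (B - B0) = B" using B(1) by auto
  then have "?\<pi> ` mp.span (B0 \<union> (B - B0)) = ?\<pi> ` forms j"
    using spB[of B] B(4) by auto
  then have "Q.dimension (card (B - B0)) ?K (?\<pi> ` forms j)"
    using ind[of "B - B0"] finB by simp
  then have "hilbert_function I j = card (B - B0)"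
    unfolding hilbert_function_def using Q.dimI[OF K] by (simp add: over_def)
  then show ?thesis
    using B(1) finB cardB B0(4) by (metis card_Diff_subset card_mono finite_subset
        le_add_diff_inverse2)
qed

section \<open>The degree parts of an ideal generated by forms\<close>

definition gens :: "(nat \<Rightarrow> ('v, 'k::field) mpoly) \<Rightarrow> nat \<Rightarrow> nat \<Rightarrow> nat \<Rightarrow> ('v, 'k) mpoly set" where
  "gens F r d j = {xmon a * F i | a i. i \<in> {1..r} \<and> mon_degree a + d = j}"

lemma gensI: "i \<in> {1..r} \<Longrightarrow> mon_degree a + d = j \<Longrightarrow> xmon a * F i \<in> gens F r d j"
  unfolding gens_def by blast

lemma gensE:
  assumes "p \<in> gens F r d j"
  obtains a i where "p = xmon a * F i" "i \<in> {1..r}" "mon_degree a + d = j"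
  using assms unfolding gens_def by blast

text \<open>The homogeneous component of degree \<open>j\<close>.\<close>

definition hproj :: "nat \<Rightarrow> ('v, 'k::field) mpoly \<Rightarrow> ('v, 'k) mpoly" where
  "hproj j p = (\<Sum>a | a \<in> Poly_Mapping.keys p \<and> mon_degree a = j. Poly_Mapping.single a
      (Poly_Mapping.lookup p a))"

lemma lookup_hproj: "Poly_Mapping.lookup (hproj j p) m = (if mon_degree m = j then
    Poly_Mapping.lookup p m else 0)"
  unfolding hproj_def lookup_sum lookup_single when_def by (auto simp: in_keys_iff)

lemma hproj_sum: "hproj j (sum f A) = (\<Sum>x\<in>A. hproj j (f x))"
  by (rule poly_mapping_eqI) (simp add: lookup_hproj lookup_sum)

lemma hproj_scale: "hproj j (const_poly c * p) = const_poly c * hproj j p"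
  by (rule poly_mapping_eqI) (simp add: lookup_hproj)

lemma hproj_forms: "p \<in> forms i \<Longrightarrow> hproj j p = (if i = j then p else 0)"
  by (rule poly_mapping_eqI) (auto simp: lookup_hproj forms_def in_keys_iff)

lemma forms_mult: "p \<in> forms i \<Longrightarrow> q \<in> forms j \<Longrightarrow> p * q \<in> forms (i + j)"
  unfolding forms_def using keys_mult[of p q] by (fastforce simp: mon_degree_add)

lemma monom_mult_form: "F \<in> forms d \<Longrightarrow> xmon a * F \<in> forms (mon_degree a + d)"
  by (intro forms_mult) (auto simp: forms_def)

lemma gens_forms: "(\<And>i. i \<in> {1..r} \<Longrightarrow> F i \<in> forms d) \<Longrightarrow> gens F r d j \<subseteq> forms j"
  by (auto simp: gens_def intro: monom_mult_form)

text \<open>Take the component of degree \<open>j\<close> of \<open>\<Sum> g\<^sub>i F\<^sub>i\<close> and expand each \<open>g\<^sub>i\<close> into monomials: the terms of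
  the wrong degree disappear.\<close>

lemma ideal_degree_part:
  fixes F :: "nat \<Rightarrow> ('v, 'k::field) mpoly"
  assumes F: "\<And>i. i \<in> {1..r} \<Longrightarrow> F i \<in> forms d"
  shows "ideal_of (F ` {1..r}) \<inter> forms j = mp.span (gens F r d j)"
proof
  show "ideal_of (F ` {1..r}) \<inter> forms j \<subseteq> mp.span (gens F r d j)"
  proof
    fix p assume p: "p \<in> ideal_of (F ` {1..r}) \<inter> forms j"
    then have "p \<in> {\<Sum>i\<in>{1..r}. g i * F i | g. True}" by (simp only: ideal_of_image Int_iff)
    then obtain g where g: "p = (\<Sum>i\<in>{1..r}. g i * F i)" by blast
    have "p = hproj j p" using p hproj_forms[of p j j] by simp
    also have "\<dots> = (\<Sum>i\<in>{1..r}. hproj j (g i * F i))" unfolding g hproj_sum ..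
    also have "\<dots> \<in> mp.span (gens F r d j)"
    proof (rule mp.span_sum)
      fix i assume i: "i \<in> {1..r}"
      let ?c = "\<lambda>a. Poly_Mapping.lookup (g i) a"
      have "g i * F i = (\<Sum>a\<in>Poly_Mapping.keys (g i). const_poly (?c a) * (xmon a * F i))"
        by (subst poly_sum_monoms[of "g i"]) (simp add: sum_distrib_right mult.assoc)
      then have "hproj j (g i * F i) = (\<Sum>a\<in>Poly_Mapping.keys (g i). const_poly (?c a) * hproj j
          (xmon a * F i))"
        by (simp add: hproj_sum hproj_scale)
      also have "\<dots> \<in> mp.span (gens F r d j)"
      proof (intro mp.span_sum mp.span_scale)
        fix a
        show "hproj j (xmon a * F i) \<in> mp.span (gens F r d j)"
          unfolding hproj_forms[OF monom_mult_form[OF F[OF i]]]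
          using i by (auto simp: gens_def mp.span_zero intro!: mp.span_base)
      qed
      finally show "hproj j (g i * F i) \<in> mp.span (gens F r d j)" .
    qed
    finally show "p \<in> mp.span (gens F r d j)" .
  qed
  note D = ideal_poly_ringD[OF ideal_ideal_of[of "F ` {1..r}"]]
  have sub: "mp.subspace (ideal_of (F ` {1..r}))"
    unfolding mp.subspace_def using D by auto
  have "gens F r d j \<subseteq> ideal_of (F ` {1..r})"
  proof -
    have "F i \<in> ideal_of (F ` {1..r})" if "i \<in> {1..r}" for i
      using ring.genideal_self[OF ring_poly_ring, of "F ` {1..r}"] that unfolding ideal_of_def by
          auto
    then show ?thesis using D(3) by (auto simp: gens_def)
  qed
  then have "mp.span (gens F r d j) \<subseteq> ideal_of (F ` {1..r})"
    using mp.span_minimal sub by blast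
  moreover have "mp.span (gens F r d j) \<subseteq> forms j"
    by (rule mp.span_minimal[OF gens_forms[OF F] subspace_forms])
  ultimately show "mp.span (gens F r d j) \<subseteq> ideal_of (F ` {1..r}) \<inter> forms j" by blast
qed

lemma one_notin_ideal:
  fixes F :: "nat \<Rightarrow> ('v, 'k::field) mpoly"
  assumes F: "\<And>i. i \<in> {1..r} \<Longrightarrow> F i \<in> forms d" and "d > 0"
  shows "1 \<notin> ideal_of (F ` {1..r})"
proof
  assume "1 \<in> ideal_of (F ` {1..r})"
  moreover have "(1 :: ('v, 'k) mpoly) \<in> forms 0" by (simp add: forms_def)
  moreover have "ideal_of (F ` {1..r}) \<inter> forms 0 = mp.span (gens F r d 0)"
    by (rule ideal_degree_part[OF F])
  ultimately have "1 \<in> mp.span (gens F r d 0)" by blast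
  moreover have "gens F r d 0 = {}" using \<open>d > 0\<close> by (auto simp: gens_def)
  ultimately show False by simp
qed

section \<open>Relations between Hilbert functions\<close>

text \<open>The Hilbert function of the ideal of \<open>F 1, \<dots>, F r\<close> (see \<open>hilbert_function_hf\<close>), as an integer and
  in terms of ranks only.\<close>

definition hf :: "(nat \<Rightarrow> ('v::finite, 'k::field) mpoly) \<Rightarrow> nat \<Rightarrow> nat \<Rightarrow> nat \<Rightarrow> int" where
  "hf F r d j = int (card {a :: 'v \<Rightarrow>\<^sub>0 nat. mon_degree a = j}) - int (mp.dim (gens F r d j))"

lemma finite_gens [simp]: "finite (gens F r d j :: ('v::finite, 'k::field) mpoly set)"
proof -
  have "gens F r d j \<subseteq> (\<lambda>(i, a). xmon a * F i) ` ({1..r} \<times> {a. mon_degree a = j - d})"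
    by (auto simp: gens_def)
  then show ?thesis by (rule finite_subset) (simp add: finite_monomials)
qed

lemma card_gens_le:
  fixes F :: "nat \<Rightarrow> ('v::finite, 'k::field) mpoly"
  shows "card (gens F r d (d + e)) \<le> r * card {a :: 'v \<Rightarrow>\<^sub>0 nat. mon_degree a = e}"
proof -
  have "gens F r d (d + e) \<subseteq> (\<lambda>(i, a). xmon a * F i) ` ({1..r} \<times> {a. mon_degree a = e})"
    by (auto simp: gens_def)
  then have "card (gens F r d (d + e)) \<le> card ({1..r} \<times> {a :: 'v \<Rightarrow>\<^sub>0 nat. mon_degree a = e})"
    by (rule surj_card_le[rotated]) (simp add: finite_monomials)
  then show ?thesis by (simp add: card_cartesian_product)
qed

lemma rank_ge_iff_dim: "finite S \<Longrightarrow> rank_ge S n \<longleftrightarrow> n \<le> mp.dim S"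
  using rank_ge_dim[OF _ mp.span_superset, of S n] rank_ge_dim_self[OF _ mp.span_superset, of S]
    rank_ge_less[of S "mp.dim S" n] by blast

lemma dim_union_le:
  assumes "finite S" "finite T"
  shows "mp.dim (S \<union> T) \<le> mp.dim S + card T"
proof -
  obtain C where C: "C \<subseteq> S" "mp.independent C" "S \<subseteq> mp.span C" "card C = mp.dim S"
    by (rule mp.basis_exists)
  have fin: "finite (C \<union> T)" using C(1) assms finite_subset by auto
  have "S \<union> T \<subseteq> mp.span (C \<union> T)"
    using C(3) mp.span_mono[of C "C \<union> T"] by (auto intro: mp.span_base)
  then have "mp.dim (S \<union> T) \<le> card (C \<union> T)"
    by (rule mp.dim_le_card[OF _ fin])
  also have "\<dots> \<le> mp.dim S + card T" using C(4) card_Un_le[of C T] by simp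
  finally show ?thesis .
qed

lemma hilbert_function_hf:
  fixes F :: "nat \<Rightarrow> ('v::finite, 'k::field) mpoly"
  assumes "\<And>i. i \<in> {1..r} \<Longrightarrow> F i \<in> forms d" "d > 0"
  shows "int (hilbert_function (ideal_of (F ` {1..r})) j) = hf F r d j"
proof -
  have "1 \<notin> ideal_of (F ` {1..r})" by (rule one_notin_ideal[OF assms])
  moreover have "ideal_of (F ` {1..r}) \<inter> forms j = mp.span (gens F r d j)"
    by (rule ideal_degree_part[OF assms(1)])
  ultimately show ?thesis
    using hilbert_function_eq[OF ideal_ideal_of, of "F ` {1..r}" j] by (simp add: hf_def)
qed

lemma hf_nonneg:
  fixes F :: "nat \<Rightarrow> ('v::finite, 'k::field) mpoly"
  assumes F: "\<And>i. i \<in> {1..r} \<Longrightarrow> F i \<in> forms d"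
  shows "hf F r d j \<ge> 0"
proof -
  have "mp.dim (gens F r d j) \<le> card (xmon ` {a :: 'v \<Rightarrow>\<^sub>0 nat. mon_degree a = j} :: ('v, 'k) mpoly
      set)"
    using gens_forms[OF F] by (intro mp.dim_le_card) (auto simp: forms_eq_span finite_monomials)
  also have "\<dots> \<le> card {a :: 'v \<Rightarrow>\<^sub>0 nat. mon_degree a = j}"
    by (rule card_image_le[OF finite_monomials])
  finally show ?thesis by (simp add: hf_def)
qed

lemma hf_0:
  fixes F :: "nat \<Rightarrow> ('v::finite, 'k::field) mpoly"
  shows "hf F 0 d j = int (card {a :: 'v \<Rightarrow>\<^sub>0 nat. mon_degree a = j})"
proof -
  have "gens F 0 d j = {}" by (auto simp: gens_def)
  then show ?thesis using mp.dim_eq_card_independent[OF mp.independent_empty] by (simp add: hf_def)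
qed

lemma hf_less: "j < d \<Longrightarrow> hf F r d j = hf F 0 d j"
proof -
  assume "j < d"
  then have "gens F r d j = {}" "gens F 0 d j = {}" by (auto simp: gens_def)
  then show ?thesis by (simp add: hf_def)
qed

lemma hf_Suc_le: "hf F (Suc r) d j \<le> hf F r d j"
proof -
  have "gens F r d j \<subseteq> mp.span (gens F (Suc r) d j)"
  proof
    fix p assume "p \<in> gens F r d j"
    then obtain a i where "p = xmon a * F i" "i \<in> {1..r}" "mon_degree a + d = j" by (rule gensE)
    then show "p \<in> mp.span (gens F (Suc r) d j)"
      by (auto intro!: mp.span_base gensI)
  qed
  then have "mp.dim (gens F r d j) \<le> mp.dim (gens F (Suc r) d j)"
    by (rule dim_mono_finite[OF finite_gens])
  then show ?thesis by (simp add: hf_def)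
qed

lemma hf_ge:
  fixes F :: "nat \<Rightarrow> ('v::finite, 'k::field) mpoly"
  shows "hf F r d (d + e) \<ge> hf F 0 d (d + e) - int r * hf F 0 d e"
proof -
  have "mp.dim (gens F r d (d + e)) \<le> r * card {a :: 'v \<Rightarrow>\<^sub>0 nat. mon_degree a = e}"
    using mp.dim_le_card'[OF finite_gens] card_gens_le by (rule order_trans)
  then have "int (mp.dim (gens F r d (d + e))) \<le> int r * int (card {a :: 'v \<Rightarrow>\<^sub>0 nat. mon_degree a
      = e})"
    by (metis of_nat_le_iff of_nat_mult)
  then show ?thesis unfolding hf_0 by (simp add: hf_def)
qed

text \<open>Multiplication by the last form induces an exact sequence
  \<open>(S/I)\<^sub>e \<rightarrow> (S/I)\<^bsub>d+e\<^esub> \<rightarrow> (S/I')\<^bsub>d+e\<^esub> \<rightarrow> 0\<close>, where \<open>I'\<close> is generated by \<open>I\<close> and that form. In terms of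
  generators: multiples of the last form by elements of \<open>I\<^sub>e\<close> already lie in \<open>I\<close>, so only a complement
  of \<open>I\<^sub>e\<close> in \<open>S\<^sub>e\<close> contributes new ones.\<close>

lemma hf_exact:
  fixes F :: "nat \<Rightarrow> ('v::finite, 'k::field) mpoly"
  assumes F: "\<And>i. i \<in> {1..Suc r} \<Longrightarrow> F i \<in> forms d"
  shows "hf F r d (d + e) \<le> hf F (Suc r) d (d + e) + hf F r d e"
proof -
  let ?G = "gens F r d"
  obtain B0 where B0: "B0 \<subseteq> ?G e" "mp.independent B0" "?G e \<subseteq> mp.span B0" "card B0 = mp.dim (?G e)"
    by (rule mp.basis_exists)
  have "?G e \<subseteq> forms e" by (rule gens_forms) (use F in auto)
  then have B0f: "B0 \<subseteq> forms e" using B0(1) by blast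
  obtain B where B: "B0 \<subseteq> B" "B \<subseteq> forms e" "mp.independent B" "forms e \<subseteq> mp.span B"
    using mp.maximal_independent_subset_extend[OF B0f B0(2)] by auto
  let ?M = "xmon ` {a :: 'v \<Rightarrow>\<^sub>0 nat. mon_degree a = e} :: ('v, 'k) mpoly set"
  have finM: "finite ?M" by (rule finite_imageI[OF finite_monomials])
  have finB: "finite B" and "card B \<le> card ?M"
    using mp.independent_span_bound[OF finM B(3)] B(2) forms_eq_span by blast+
  then have cardB: "card B \<le> card {a :: 'v \<Rightarrow>\<^sub>0 nat. mon_degree a = e}"
    using card_image_le[OF finite_monomials[of e], of "xmon :: _ \<Rightarrow> ('v, 'k) mpoly"] by linarith
  let ?f = "\<lambda>p. p * F (Suc r)"
  have lin: "?f p \<in> mp.span (?f ` S)" if "p \<in> mp.span S" for p S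
    using that
  proof (induction rule: mp.span_induct_alt)
    case base show ?case by (simp add: mp.span_zero)
  next
    case (step c x y)
    have "const_poly c * (x * F (Suc r)) + y * F (Suc r) \<in> mp.span (?f ` S)"
      using step by (intro mp.span_add mp.span_scale) (auto intro: mp.span_base)
    then show ?case by (simp add: distrib_right mult.assoc)
  qed
  have fG: "?f p \<in> mp.span (?G (d + e))" if "p \<in> ?G e" for p
  proof -
    from that obtain a i where ai: "p = xmon a * F i" "i \<in> {1..r}" "mon_degree a + d = e"
      by (rule gensE)
    have Fr: "F (Suc r) \<in> forms d" using F by auto
    have "?f p = (\<Sum>b\<in>Poly_Mapping.keys (F (Suc r)).
        const_poly (Poly_Mapping.lookup (F (Suc r)) b) * (xmon (a + b) * F i))"
    proof -
      have "?f p = (xmon a * F i) * (\<Sum>b\<in>Poly_Mapping.keys (F (Suc r)).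
        const_poly (Poly_Mapping.lookup (F (Suc r)) b) * xmon b)"
        using ai(1) poly_sum_monoms[of "F (Suc r)"] by simp
      also have "\<dots> = (\<Sum>b\<in>Poly_Mapping.keys (F (Suc r)).
          const_poly (Poly_Mapping.lookup (F (Suc r)) b) * ((xmon a * xmon b) * F i))"
        by (simp add: sum_distrib_left mult_ac)
      finally show ?thesis by (simp add: mult_single)
    qed
    also have "\<dots> \<in> mp.span (?G (d + e))"
      using Fr ai by (intro mp.span_sum mp.span_scale mp.span_base gensI)
        (auto simp: forms_def mon_degree_add)
    finally show ?thesis .
  qed
  let ?C = "B - B0"
  have "gens F (Suc r) d (d + e) \<subseteq> mp.span (?G (d + e) \<union> ?f ` ?C)" (is "_ \<subseteq> mp.span ?X")
  proof
    fix p assume "p \<in> gens F (Suc r) d (d + e)"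
    then obtain a i where ai: "p = xmon a * F i" "i \<in> {1..Suc r}" "mon_degree a + d = d + e"
      by (rule gensE)
    show "p \<in> mp.span ?X"
    proof (cases "i = Suc r")
      case False
      then have "p \<in> ?G (d + e)" using ai by (auto intro!: gensI)
      then show ?thesis by (auto intro: mp.span_base)
    next
      case True
      have "xmon a \<in> forms e" using ai by (auto simp: forms_def)
      then have "?f (xmon a) \<in> mp.span (?f ` B)" using B(4) by (auto intro: lin)
      moreover have "?f ` B \<subseteq> mp.span ?X"
      proof clarify
        fix b assume b: "b \<in> B"
        show "?f b \<in> mp.span ?X"
        proof (cases "b \<in> B0")
          case True
          then have "?f b \<in> mp.span (?G (d + e))" using fG B0(1) by auto
          then show ?thesis using mp.span_mono[of "?G (d + e)" ?X] by auto
        qed (use b in \<open>auto intro: mp.span_base\<close>)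
      qed
      ultimately show ?thesis using ai True mp.span_minimal[of "?f ` B" "mp.span ?X"] by auto
    qed
  qed
  then have "mp.dim (gens F (Suc r) d (d + e)) \<le> mp.dim ?X"
    using finB by (intro dim_mono_finite) auto
  also have "\<dots> \<le> mp.dim (?G (d + e)) + card (?f ` ?C)"
    using finB by (intro dim_union_le) auto
  also have "card (?f ` ?C) \<le> card ?C" using finB by (intro card_image_le) auto
  also have "card ?C = card B - mp.dim (?G e)"
    using B(1) B0(4) finB by (simp add: card_Diff_subset finite_subset)
  finally have "mp.dim (gens F (Suc r) d (d + e)) \<le> mp.dim (?G (d + e)) + (card B - mp.dim (?G
      e))" by simp
  moreover have "mp.dim (?G e) \<le> card B" using card_mono[OF finB B(1)] B0(4) by simp
  ultimately show ?thesis using cardB by (simp add: hf_def)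
qed

lemma span_gens_mult:
  assumes "p \<in> mp.span (gens F r d j)"
  shows "xmon a * p \<in> mp.span (gens F r d (mon_degree a + j))"
  using assms
proof (induction rule: mp.span_induct_alt)
  case base show ?case by (simp add: mp.span_zero)
next
  case (step c x y)
  from step(1) obtain b i where x: "x = xmon b * F i" "i \<in> {1..r}" "mon_degree b + d = j" by (rule
      gensE)
  have "xmon a * x = xmon (a + b) * F i" using x(1) by (simp add: mult_single flip: mult.assoc)
  also have "\<dots> \<in> mp.span (gens F r d (mon_degree a + j))"
    using x by (intro mp.span_base gensI) (auto simp: mon_degree_add)
  finally have "const_poly c * (xmon a * x) + xmon a * y \<in> mp.span (gens F r d (mon_degree a + j))"
    using step by (intro mp.span_add mp.span_scale)
  then show ?case by (simp add: algebra_simps)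
qed

lemma ex_degree_predecessor:
  assumes "mon_degree a = Suc j"
  obtains v b where "a = Poly_Mapping.single v 1 + b" "mon_degree b = j"
proof -
  obtain v where v: "Poly_Mapping.lookup a v \<noteq> 0"
  proof -
    have "a \<noteq> 0" using assms by auto
    then show ?thesis using that by (metis lookup_zero poly_mapping_eqI)
  qed
  have "a = Poly_Mapping.single v 1 + (a - Poly_Mapping.single v 1)"
    using v by (intro poly_mapping_eqI) (auto simp: lookup_add lookup_minus lookup_single when_def)
  moreover from this have "mon_degree a = 1 + mon_degree (a - Poly_Mapping.single v 1)"
    by (metis mon_degree_add mon_degree_single)
  ultimately show ?thesis using that assms by auto
qed

lemma hf_0_imp_span:
  fixes F :: "nat \<Rightarrow> ('v::finite, 'k::field) mpoly"
  assumes F: "\<And>i. i \<in> {1..r} \<Longrightarrow> F i \<in> forms d" and 0: "hf F r d j = 0"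
  shows "forms j \<subseteq> mp.span (gens F r d j)"
proof -
  obtain C where C: "C \<subseteq> gens F r d j" "mp.independent C" "gens F r d j \<subseteq> mp.span C" "card C =
      mp.dim (gens F r d j)"
    by (rule mp.basis_exists)
  have "gens F r d j \<subseteq> forms j" by (rule gens_forms[OF F])
  then have Cf: "C \<subseteq> forms j" using C(1) by blast
  obtain B where B: "C \<subseteq> B" "B \<subseteq> forms j" "mp.independent B" "forms j \<subseteq> mp.span B"
    using mp.maximal_independent_subset_extend[OF Cf C(2)] by auto
  let ?M = "xmon ` {a :: 'v \<Rightarrow>\<^sub>0 nat. mon_degree a = j} :: ('v, 'k) mpoly set"
  have finM: "finite ?M" by (rule finite_imageI[OF finite_monomials])
  have finB: "finite B" and "card B \<le> card ?M"
    using mp.independent_span_bound[OF finM B(3)] B(2) forms_eq_span by blast+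
  then have "card B \<le> card C"
    using card_image_le[OF finite_monomials[of j], of "xmon :: _ \<Rightarrow> ('v, 'k) mpoly"] 0 C(4) by
        (simp add: hf_def)
  then have "C = B" using B(1) finB card_seteq by blast
  then show ?thesis using B(4) C(1) mp.span_mono by blast
qed

lemma hf_eq_0_if_rank:
  fixes F :: "nat \<Rightarrow> ('v::finite, 'k::field) mpoly"
  assumes F: "\<And>i. i \<in> {1..r} \<Longrightarrow> F i \<in> forms d"
    and "xmon ` {a. mon_degree a = j} \<subseteq> mp.span (gens F r d j)"
  shows "hf F r d j = 0"
proof -
  have "rank_ge (gens F r d j) (card {a :: 'v \<Rightarrow>\<^sub>0 nat. mon_degree a = j})"
    by (rule rank_ge_mono[OF rank_ge_monoms[OF finite_monomials] assms(2)])
  then have "hf F r d j \<le> 0" by (simp add: rank_ge_iff_dim hf_def)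
  moreover have "hf F r d j \<ge> 0" by (rule hf_nonneg[OF F])
  ultimately show ?thesis by simp
qed

text \<open>Every monomial of degree \<open>j + 1\<close> is a variable times a monomial of degree \<open>j\<close>.\<close>

lemma hf_eq_0_Suc:
  fixes F :: "nat \<Rightarrow> ('v::finite, 'k::field) mpoly"
  assumes F: "\<And>i. i \<in> {1..r} \<Longrightarrow> F i \<in> forms d" and 0: "hf F r d j = 0"
  shows "hf F r d (Suc j) = 0"
proof (rule hf_eq_0_if_rank[OF F])
  show "xmon ` {a. mon_degree a = Suc j} \<subseteq> mp.span (gens F r d (Suc j))"
  proof clarify
    fix a :: "'v \<Rightarrow>\<^sub>0 nat" assume "mon_degree a = Suc j"
    then obtain v b where ab: "a = Poly_Mapping.single v 1 + b" "mon_degree b = j"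
      by (rule ex_degree_predecessor)
    have "(xmon b :: ('v, 'k) mpoly) \<in> forms j" using ab by (simp add: forms_def)
    then have "xmon b \<in> mp.span (gens F r d j)" using hf_0_imp_span[OF F 0] by blast
    then have "xmon (Poly_Mapping.single v 1) * xmon b \<in> mp.span (gens F r d (mon_degree
        (Poly_Mapping.single v (1::nat)) + j))"
      by (rule span_gens_mult)
    then show "xmon a \<in> mp.span (gens F r d (Suc j))"
      using ab by (simp add: mult_single)
  qed
qed simp

lemma dim_image_mult_le:
  assumes "finite S"
  shows "mp.dim ((*) q ` S) \<le> mp.dim S"
proof -
  obtain C where C: "C \<subseteq> S" "mp.independent C" "S \<subseteq> mp.span C" "card C = mp.dim S"
    by (rule mp.basis_exists)
  have fin: "finite C" using C(1) assms finite_subset by auto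
  have "q * p \<in> mp.span ((*) q ` C)" if "p \<in> mp.span C" for p
    using that
  proof (induction rule: mp.span_induct_alt)
    case base show ?case by (simp add: mp.span_zero)
  next
    case (step c x y)
    then have "const_poly c * (q * x) + q * y \<in> mp.span ((*) q ` C)"
      by (intro mp.span_add mp.span_scale) (auto intro: mp.span_base)
    then show ?case by (simp add: algebra_simps)
  qed
  then have "(*) q ` S \<subseteq> mp.span ((*) q ` C)" using C(3) by auto
  then have "mp.dim ((*) q ` S) \<le> card ((*) q ` C)"
    by (rule mp.dim_le_card) (use fin in simp)
  also have "\<dots> \<le> card C" by (rule card_image_le[OF fin])
  finally show ?thesis using C(4) by simp
qed

text \<open>Independence of all products \<open>x\<^sup>a F\<^sub>i\<close> in one degree descends to the preceding degree, because
  multiplication by a variable \<open>v\<close> embeds the products of lower degree among those of higher degree.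
  In terms of dimensions: the products in degree \<open>d + e + 1\<close> are \<open>v\<close> times the products in degree
  \<open>d + e\<close>, plus those with \<open>a\<close> free of \<open>v\<close>, and the number of the latter is exactly the difference
  between the full ranks in the two degrees.\<close>

lemma full_rank_pred_degree:
  fixes F :: "nat \<Rightarrow> ('v::finite, 'k::field) mpoly"
  assumes "rank_ge (gens F r d (d + Suc e)) (r * card {a :: 'v \<Rightarrow>\<^sub>0 nat. mon_degree a = Suc e})"
  shows "rank_ge (gens F r d (d + e)) (r * card {a :: 'v \<Rightarrow>\<^sub>0 nat. mon_degree a = e})"
proof -
  obtain v :: 'v where True by simp
  let ?x = "Poly_Mapping.single v 1 :: 'v \<Rightarrow>\<^sub>0 nat"
  let ?N = "{a :: 'v \<Rightarrow>\<^sub>0 nat. mon_degree a = Suc e \<and> Poly_Mapping.lookup a v = 0}"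
  let ?Y = "{a :: 'v \<Rightarrow>\<^sub>0 nat. mon_degree a = e}"
  have finN: "finite ?N" by (rule finite_subset[OF _ finite_monomials[of "Suc e"]]) auto
  have split: "{a :: 'v \<Rightarrow>\<^sub>0 nat. mon_degree a = Suc e} = (+) ?x ` ?Y \<union> ?N"
  proof (intro equalityI subsetI)
    fix a :: "'v \<Rightarrow>\<^sub>0 nat" assume a: "a \<in> {a. mon_degree a = Suc e}"
    show "a \<in> (+) ?x ` ?Y \<union> ?N"
    proof (cases "Poly_Mapping.lookup a v = 0")
      case False
      then have eq: "a = ?x + (a - ?x)"
        by (intro poly_mapping_eqI) (auto simp: lookup_add lookup_minus lookup_single when_def)
      then have "mon_degree a = 1 + mon_degree (a - ?x)"
        by (metis mon_degree_add mon_degree_single)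
      then have "a - ?x \<in> ?Y" using a by simp
      then show ?thesis using eq by blast
    qed (use a in auto)
  qed (auto simp: mon_degree_add)
  have "(+) ?x ` ?Y \<inter> ?N = {}" by (auto simp: lookup_add)
  then have card: "card {a :: 'v \<Rightarrow>\<^sub>0 nat. mon_degree a = Suc e} = card ?Y + card ?N"
    unfolding split using finite_monomials finN by (subst card_Un_disjoint) (auto simp: card_image)
  let ?Z = "(\<lambda>(i, a). xmon a * F i) ` ({1..r} \<times> ?N)"
  have "gens F r d (d + Suc e) \<subseteq> mp.span ((*) (xmon ?x) ` gens F r d (d + e) \<union> ?Z)"
  proof
    fix p assume "p \<in> gens F r d (d + Suc e)"
    then obtain a i where ai: "p = xmon a * F i" "i \<in> {1..r}" "mon_degree a + d = d + Suc e"
      by (rule gensE)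
    then have "a \<in> (+) ?x ` ?Y \<union> ?N" using split by auto
    then show "p \<in> mp.span ((*) (xmon ?x) ` gens F r d (d + e) \<union> ?Z)"
    proof
      assume "a \<in> (+) ?x ` ?Y"
      then obtain b where b: "a = ?x + b" "mon_degree b = e" by auto
      then have "xmon b * F i \<in> gens F r d (d + e)" using ai by (intro gensI) auto
      moreover have "p = xmon ?x * (xmon b * F i)"
        using ai b by (simp add: mult_single flip: mult.assoc)
      ultimately show ?thesis by (intro mp.span_base) blast
    next
      assume "a \<in> ?N"
      then show ?thesis using ai by (intro mp.span_base UnI2) auto
    qed
  qed
  then have "mp.dim (gens F r d (d + Suc e)) \<le> mp.dim ((*) (xmon ?x) ` gens F r d (d + e) \<union> ?Z)"
    by (intro dim_mono_finite) (auto simp: finN)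
  also have "\<dots> \<le> mp.dim ((*) (xmon ?x) ` gens F r d (d + e)) + card ?Z"
    by (intro dim_union_le) (auto simp: finN)
  also have "card ?Z \<le> r * card ?N"
    using card_image_le[of "{1..r} \<times> ?N" "\<lambda>(i, a). xmon a * F i"] finN by (simp add:
        card_cartesian_product)
  also have "mp.dim ((*) (xmon ?x) ` gens F r d (d + e)) \<le> mp.dim (gens F r d (d + e))"
    by (rule dim_image_mult_le) simp
  finally have "mp.dim (gens F r d (d + Suc e)) \<le> mp.dim (gens F r d (d + e)) + r * card ?N" by simp
  then show ?thesis using assms by (simp add: rank_ge_iff_dim card algebra_simps)
qed

lemma full_rank_le_degree:
  fixes F :: "nat \<Rightarrow> ('v::finite, 'k::field) mpoly"
  assumes "rank_ge (gens F r d (d + e')) (r * card {a :: 'v \<Rightarrow>\<^sub>0 nat. mon_degree a = e'})" "e \<le> e'"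
  shows "rank_ge (gens F r d (d + e)) (r * card {a :: 'v \<Rightarrow>\<^sub>0 nat. mon_degree a = e})"
  using assms(2,1) by (induction rule: inc_induct) (auto intro: full_rank_pred_degree)

lemma full_rank_fewer_forms:
  fixes F :: "nat \<Rightarrow> ('v::finite, 'k::field) mpoly"
  assumes "rank_ge (gens F r' d (d + e)) (r' * card {a :: 'v \<Rightarrow>\<^sub>0 nat. mon_degree a = e})" "r \<le> r'"
  shows "rank_ge (gens F r d (d + e)) (r * card {a :: 'v \<Rightarrow>\<^sub>0 nat. mon_degree a = e})"
  using assms(2,1)
proof (induction rule: inc_induct)
  case (step n)
  let ?Y = "{a :: 'v \<Rightarrow>\<^sub>0 nat. mon_degree a = e}"
  let ?Z = "(\<lambda>a. xmon a * F (Suc n)) ` ?Y"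
  have "gens F (Suc n) d (d + e) \<subseteq> mp.span (gens F n d (d + e) \<union> ?Z)"
  proof
    fix p assume "p \<in> gens F (Suc n) d (d + e)"
    then obtain a i where ai: "p = xmon a * F i" "i \<in> {1..Suc n}" "mon_degree a + d = d + e"
      by (rule gensE)
    show "p \<in> mp.span (gens F n d (d + e) \<union> ?Z)"
    proof (cases "i = Suc n")
      case True then show ?thesis using ai by (intro mp.span_base UnI2) auto
    next
      case False then show ?thesis using ai by (auto intro!: mp.span_base UnI1 gensI)
    qed
  qed
  then have "mp.dim (gens F (Suc n) d (d + e)) \<le> mp.dim (gens F n d (d + e) \<union> ?Z)"
    by (intro dim_mono_finite) (auto simp: finite_monomials)
  also have "\<dots> \<le> mp.dim (gens F n d (d + e)) + card ?Z"
    by (intro dim_union_le) (auto simp: finite_monomials)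
  also have "card ?Z \<le> card ?Y" by (rule card_image_le[OF finite_monomials])
  finally show ?case using step by (simp add: rank_ge_iff_dim)
qed

text \<open>The coefficients of \<open>(1 - t\<^sup>d)\<^sup>r \<Sum> s\<^sub>j t\<^sup>j\<close>, see \<open>fps_nth_expected\<close>.\<close>

primrec iterated_difference :: "nat \<Rightarrow> (nat \<Rightarrow> int) \<Rightarrow> nat \<Rightarrow> nat \<Rightarrow> int" where
  "iterated_difference d s 0 j = s j"
| "iterated_difference d s (Suc r) j =
     iterated_difference d s r j - (if d \<le> j then iterated_difference d s r (j - d) else 0)"

text \<open>Let \<open>H\<^sub>r\<close> be the generating function of \<open>H r\<close>. The hypothesis says \<open>H\<^sub>r \<le> H\<^bsub>r+1\<^esub> / (1 - t\<^sup>d)\<close>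
  coefficientwise. Division by \<open>1 - t\<^sup>d\<close> preserves such inequalities, so that
  \<open>H\<^sub>0 \<le> H\<^sub>1 / (1 - t\<^sup>d) \<le> \<dots> \<le> H\<^sub>n / (1 - t\<^sup>d)\<^sup>n\<close>, and the upper bound for \<open>H\<^sub>n\<close> makes the last term at most
  \<open>H\<^sub>0\<close>. Hence equality holds everywhere.\<close>

lemma chain_of_inequalities_exact:
  fixes H :: "nat \<Rightarrow> nat \<Rightarrow> int"
  assumes d: "d > 0"
    and step: "\<And>r j. r < n \<Longrightarrow> H r j \<le> H (Suc r) j + (if d \<le> j then H r (j - d) else 0)"
    and start: "\<And>j. H 0 j = s j"
    and final: "\<And>j. H n j \<le> iterated_difference d s n j"
    and "r \<le> n"
  shows "H r j = iterated_difference d s r j"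
proof -
  \<comment> \<open>Upper bounds propagate from \<open>n\<close> down to \<open>0\<close>; the equality at \<open>0\<close> then propagates back up as lower
     bounds.\<close>
  have up: "H r j \<le> iterated_difference d s r j" if "r \<le> n" for r j
    using that
  proof (induction arbitrary: j rule: inc_induct)
    case base show ?case by (rule final)
  next
    case (step m)
    show ?case
    proof (induction j rule: less_induct)
      case (less j)
      have "H m (j - d) \<le> iterated_difference d s m (j - d)" if "d \<le> j"
        using less.IH[of "j - d"] d that by simp
      moreover have "H (Suc m) j \<le> iterated_difference d s (Suc m) j" by (rule step.IH)
      ultimately show ?case using assms(2)[of m j] step.hyps by (auto split: if_splits)
    qed
  qed
  show ?thesis using \<open>r \<le> n\<close>
  proof (induction r arbitrary: j)
    case 0 show ?case by (simp add: start)
  next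
    case (Suc r)
    then have "H r j = iterated_difference d s r j" "H r (j - d) = iterated_difference d s r (j -
        d)" by auto
    moreover have "H r j \<le> H (Suc r) j + (if d \<le> j then H r (j - d) else 0)"
      using Suc.prems by (intro step) auto
    ultimately have "iterated_difference d s (Suc r) j \<le> H (Suc r) j" by auto
    then show ?case using up[OF Suc.prems, of j] by simp
  qed
qed

section \<open>Polynomial functions of the coefficients\<close>

definition eval_mon :: "('v \<Rightarrow> 'k) \<Rightarrow> ('v \<Rightarrow>\<^sub>0 nat) \<Rightarrow> 'k::comm_semiring_1" where
  "eval_mon x m = (\<Prod>v\<in>Poly_Mapping.keys m. x v ^ Poly_Mapping.lookup m v)"

lemma eval_mon_superset:
  assumes "finite A" "Poly_Mapping.keys m \<subseteq> A"
  shows "eval_mon x m = (\<Prod>v\<in>A. x v ^ Poly_Mapping.lookup m v)"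
  unfolding eval_mon_def
  by (rule prod.mono_neutral_left) (use assms in \<open>auto simp: in_keys_iff\<close>)

lemma eval_mon_add: "eval_mon x (a + b) = eval_mon x a * eval_mon x b"
proof -
  let ?A = "Poly_Mapping.keys a \<union> Poly_Mapping.keys b"
  have "Poly_Mapping.keys (a + b) \<subseteq> ?A" by (rule keys_add)
  then show ?thesis
    by (simp add: eval_mon_superset[of ?A] lookup_add power_add prod.distrib)
qed

lemma eval_mpoly_add: "eval_mpoly x (p + q) = eval_mpoly x p + eval_mpoly x (q :: ('v, 'k::field)
    mpoly)"
  unfolding eval_mpoly_def
  by (rule setsum_keys_plus_distrib) (simp_all add: distrib_right)

lemma eval_mpoly_single: "eval_mpoly x (Poly_Mapping.single m c) = c * eval_mon x m"
  for x :: "'v \<Rightarrow> 'k::field"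
  by (simp add: eval_mpoly_def eval_mon_def)

lemma eval_mpoly_0: "eval_mpoly x 0 = 0"
  by (simp add: eval_mpoly_def)

lemma mpoly_induct [case_names zero add]:
  fixes p :: "('v, 'k::field) mpoly"
  assumes "P 0" "\<And>m c p. P p \<Longrightarrow> P (Poly_Mapping.single m c + p)"
  shows "P p"
proof -
  have "P (\<Sum>a\<in>A. const_poly (c a) * xmon a)" if "finite A" for A and c :: "_ \<Rightarrow> 'k"
    using that
    by (induction A rule: finite_induct) (auto simp: assms const_poly_def mult_single)
  then show ?thesis by (subst poly_sum_monoms) simp
qed

lemma eval_mpoly_single_mult:
  "eval_mpoly x (Poly_Mapping.single m c * p) = c * eval_mon x m * eval_mpoly x (p :: ('v,
      'k::field) mpoly)"
  by (induction p rule: mpoly_induct)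
    (auto simp: eval_mpoly_0 distrib_left mult_single eval_mpoly_add eval_mpoly_single eval_mon_add)

lemma eval_mpoly_mult: "eval_mpoly x (p * q) = eval_mpoly x p * eval_mpoly x (q :: ('v, 'k::field)
    mpoly)"
  by (induction p rule: mpoly_induct)
    (auto simp: eval_mpoly_0 distrib_right eval_mpoly_add eval_mpoly_single_mult eval_mpoly_single)

text \<open>Polynomial functions on \<open>(S\<^sub>d)\<^sup>r\<close>, generated syntactically. The functions are defined on all
  tuples, but only the coefficients of monomials of degree \<open>d\<close> may be used.\<close>

inductive polyfun :: "nat \<Rightarrow> nat \<Rightarrow> ((nat \<Rightarrow> ('v, 'k::field) mpoly) \<Rightarrow> 'k) \<Rightarrow> bool" for d r where
  polyfun_const: "polyfun d r (\<lambda>_. c)"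
| polyfun_coord: "i \<in> {1..r} \<Longrightarrow> mon_degree m = d \<Longrightarrow> polyfun d r (\<lambda>F. Poly_Mapping.lookup (F i) m)"
| polyfun_add: "polyfun d r f \<Longrightarrow> polyfun d r g \<Longrightarrow> polyfun d r (\<lambda>F. f F + g F)"
| polyfun_mult: "polyfun d r f \<Longrightarrow> polyfun d r g \<Longrightarrow> polyfun d r (\<lambda>F. f F * g F)"

lemma polyfun_diff:
  assumes "polyfun d r f" "polyfun d r g" shows "polyfun d r (\<lambda>F. f F - g F)"
  using polyfun_add[OF assms(1) polyfun_mult[OF polyfun_const[of d r "-1"] assms(2)]] by simp

lemma polyfun_imp_polynomial:
  assumes "polyfun d r f"
  shows "\<exists>P\<in>coord_ring d r. \<forall>F :: nat \<Rightarrow> ('v, 'k::field) mpoly. eval_mpoly (coords F) P = f F"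
  using assms
proof induction
  case (polyfun_const c)
  show ?case
    by (rule bexI[of _ "Poly_Mapping.single 0 c"]) (auto simp: eval_mpoly_single eval_mon_def
        coord_ring_def)
next
  case (polyfun_coord i m)
  let ?P = "Poly_Mapping.single (Poly_Mapping.single (i, m) 1) 1 :: (nat \<times> ('v \<Rightarrow>\<^sub>0 nat), 'k) mpoly"
  have "?P \<in> coord_ring d r"
    using polyfun_coord by (auto simp: coord_ring_def coord_indices_def)
  moreover have "eval_mpoly (coords F) ?P = Poly_Mapping.lookup (F i) m" for F :: "nat \<Rightarrow> ('v, 'k)
      mpoly"
    unfolding eval_mpoly_single by (simp add: eval_mon_def coords_def)
  ultimately show ?case by blast
next
  case (polyfun_add f g)
  then obtain P Q where "P \<in> coord_ring d r" "Q \<in> coord_ring d r"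
    "\<forall>F. eval_mpoly (coords F) P = f F" "\<forall>F. eval_mpoly (coords F) Q = g F" by blast
  moreover from this have "P + Q \<in> coord_ring d r"
    using keys_add[of P Q] unfolding coord_ring_def by blast
  ultimately show ?case by (intro bexI[of _ "P + Q"]) (auto simp: eval_mpoly_add)
next
  case (polyfun_mult f g)
  then obtain P Q where PQ: "P \<in> coord_ring d r" "Q \<in> coord_ring d r"
    "\<forall>F. eval_mpoly (coords F) P = f F" "\<forall>F. eval_mpoly (coords F) Q = g F" by blast
  have "P * Q \<in> coord_ring d r"
    unfolding coord_ring_def
  proof (intro CollectI ballI)
    fix m assume "m \<in> Poly_Mapping.keys (P * Q)"
    then obtain a b where ab: "m = a + b" "a \<in> Poly_Mapping.keys P" "b \<in> Poly_Mapping.keys Q"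
      using keys_mult[of P Q] by blast
    have "Poly_Mapping.keys m \<subseteq> Poly_Mapping.keys a \<union> Poly_Mapping.keys b"
      unfolding ab(1) by (rule keys_add)
    also have "\<dots> \<subseteq> coord_indices d r"
      using ab(2,3) PQ(1,2) by (simp add: coord_ring_def)
    finally show "Poly_Mapping.keys m \<subseteq> coord_indices d r" .
  qed
  then show ?case using PQ by (intro bexI[of _ "P * Q"]) (auto simp: eval_mpoly_mult)
qed

definition tuple_line :: "nat \<Rightarrow> (nat \<Rightarrow> ('v, 'k::field) mpoly) \<Rightarrow> (nat \<Rightarrow> ('v, 'k) mpoly) \<Rightarrow> 'k \<Rightarrow> nat
    \<Rightarrow> ('v, 'k) mpoly" where
  "tuple_line r F0 F1 t = (\<lambda>i\<in>{1..r}. F0 i + const_poly t * (F1 i - F0 i))"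

lemma polyfun_on_line:
  assumes "polyfun d r f"
  shows "\<exists>q. \<forall>t. poly q t = f (tuple_line r F0 F1 t)"
  using assms
proof induction
  case (polyfun_const c)
  show ?case by (rule exI[of _ "[:c:]"]) simp
next
  case (polyfun_coord i m)
  then show ?case
    by (intro exI[of _ "[:Poly_Mapping.lookup (F0 i) m, Poly_Mapping.lookup (F1 i - F0 i) m:]"])
      (simp add: tuple_line_def lookup_add)
next
  case (polyfun_add f g)
  then obtain p q where
    "\<forall>t. poly p t = f (tuple_line r F0 F1 t)"
    "\<forall>t. poly q t = g (tuple_line r F0 F1 t)" by blast
  then show ?case by (intro exI[of _ "p + q"]) simp
next
  case (polyfun_mult f g)
  then obtain p q where
    "\<forall>t. poly p t = f (tuple_line r F0 F1 t)"
    "\<forall>t. poly q t = g (tuple_line r F0 F1 t)" by blast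
  then show ?case by (intro exI[of _ "p * q"]) simp
qed

text \<open>Two nonempty principal open sets meet: on the line through a point of each, both functions are
  nonzero univariate polynomials, and their product has only finitely many roots.\<close>

lemma common_nonzero_of_polyfuns:
  fixes f g :: "(nat \<Rightarrow> ('v, 'k::field_char_0) mpoly) \<Rightarrow> 'k"
  assumes f: "polyfun d r f" "F0 \<in> form_tuples d r" "f F0 \<noteq> 0"
    and g: "polyfun d r g" "F1 \<in> form_tuples d r" "g F1 \<noteq> 0"
  shows "\<exists>F\<in>form_tuples d r. f F \<noteq> 0 \<and> g F \<noteq> 0"
proof -
  let ?L = "tuple_line r F0 F1"
  obtain p q where pq: "\<And>t. poly p t = f (?L t)" "\<And>t. poly q t = g (?L t)"
    using polyfun_on_line[OF f(1)] polyfun_on_line[OF g(1)] by blast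
  have L0: "?L 0 = F0" and L1: "?L 1 = F1"
    using f(2) g(2)
    by (auto simp: tuple_line_def form_tuples_def PiE_def extensional_def const_poly_def fun_eq_iff)
  have "p \<noteq> 0" "q \<noteq> 0" using pq(1)[of 0] pq(2)[of 1] f(3) g(3) L0 L1 by auto
  then have "finite {t. poly (p * q) t = 0}" by (intro poly_roots_finite) simp
  then obtain t where "poly (p * q) t \<noteq> 0"
    using infinite_UNIV_char_0 ex_new_if_finite by blast
  then have "f (?L t) \<noteq> 0" "g (?L t) \<noteq> 0" using pq by auto
  moreover have "?L t \<in> form_tuples d r"
  proof -
    have "F0 i + const_poly t * (F1 i - F0 i) \<in> forms d" if "i \<in> {1..r}" for i
    proof -
      have "F0 i \<in> forms d" "F1 i \<in> forms d" using f(2) g(2) that by (auto simp: form_tuples_def)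
      then show ?thesis
        using subspace_forms by (intro mp.subspace_add mp.subspace_scale mp.subspace_diff) auto
    qed
    then show ?thesis by (auto simp: tuple_line_def form_tuples_def)
  qed
  ultimately show ?thesis by blast
qed

section \<open>Generic properties and ranks\<close>

text \<open>The property holds on a nonempty principal open set.\<close>

definition generic :: "nat \<Rightarrow> nat \<Rightarrow> ((nat \<Rightarrow> ('v, 'k::field) mpoly) \<Rightarrow> bool) \<Rightarrow> bool" where
  "generic d r Q \<longleftrightarrow> (\<exists>f. polyfun d r f \<and> (\<exists>F\<in>form_tuples d r. f F \<noteq> 0) \<and>
     (\<forall>F\<in>form_tuples d r. f F \<noteq> 0 \<longrightarrow> Q F))"

lemma generic_True: "generic d r (\<lambda>_. True)"
proof -
  have "(\<lambda>i\<in>{1..r}. 0) \<in> form_tuples d r" by (auto simp: form_tuples_def forms_def)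
  then show ?thesis unfolding generic_def by (intro exI[of _ "\<lambda>_. 1"]) (auto intro: polyfun_const)
qed

lemma generic_mono:
  "generic d r Q \<Longrightarrow> (\<And>F. F \<in> form_tuples d r \<Longrightarrow> Q F \<Longrightarrow> Q' F) \<Longrightarrow> generic d r Q'"
  unfolding generic_def by blast

lemma generic_conj:
  fixes Q :: "(nat \<Rightarrow> ('v, 'k::field_char_0) mpoly) \<Rightarrow> bool"
  assumes "generic d r Q" "generic d r Q'"
  shows "generic d r (\<lambda>F. Q F \<and> Q' F)"
proof -
  obtain f F0 where f: "polyfun d r f" "F0\<in>form_tuples d r" "f F0 \<noteq> 0"
     "\<forall>F\<in>form_tuples d r. f F \<noteq> 0 \<longrightarrow> Q F" using assms(1) unfolding generic_def by blast
  obtain g F1 where g: "polyfun d r g" "F1\<in>form_tuples d r" "g F1 \<noteq> 0"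
     "\<forall>F\<in>form_tuples d r. g F \<noteq> 0 \<longrightarrow> Q' F" using assms(2) unfolding generic_def by blast
  show ?thesis unfolding generic_def
    using common_nonzero_of_polyfuns[OF f(1-3) g(1-3)] polyfun_mult[OF f(1) g(1)] f(4) g(4)
    by (intro exI[of _ "\<lambda>F. f F * g F"]) auto
qed

lemma generic_ball:
  fixes Q :: "'a \<Rightarrow> (nat \<Rightarrow> ('v, 'k::field_char_0) mpoly) \<Rightarrow> bool"
  assumes "finite A" "\<And>a. a \<in> A \<Longrightarrow> generic d r (Q a)"
  shows "generic d r (\<lambda>F. \<forall>a\<in>A. Q a F)"
  using assms by (induction A rule: finite_induct) (auto intro: generic_True generic_conj)

lemma generic_open:
  assumes "generic d r Q"
  shows "\<exists>U. zariski_open d r U \<and> U \<noteq> {} \<and> (\<forall>F\<in>U. F \<in> form_tuples d r \<and> Q F)"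
proof -
  obtain f F0 where f: "polyfun d r f" "F0\<in>form_tuples d r" "f F0 \<noteq> 0"
     "\<forall>F\<in>form_tuples d r. f F \<noteq> 0 \<longrightarrow> Q F" using assms(1) unfolding generic_def by blast
  obtain P where P: "P \<in> coord_ring d r" "\<And>F. eval_mpoly (coords F) P = f F"
    using polyfun_imp_polynomial[OF f(1)] by blast
  let ?U = "{F \<in> form_tuples d r. f F \<noteq> 0}"
  have "zariski_closed d r (form_tuples d r - ?U)"
    unfolding zariski_closed_def using P by (intro exI[of _ "{P}"]) auto
  then have "zariski_open d r ?U" by (auto simp: zariski_open_def)
  then show ?thesis using f by (intro exI[of _ ?U]) auto
qed

lemma rank_ge_insertD:
  assumes "finite S" "rank_ge (insert v S) (Suc n)"
  shows "rank_ge S n"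
proof -
  have "Suc n \<le> mp.dim (insert v S)" using assms by (simp add: rank_ge_iff_dim)
  also have "\<dots> \<le> mp.dim S + card {v}" using dim_union_le[of S "{v}"] assms by simp
  finally show ?thesis using assms by (simp add: rank_ge_iff_dim)
qed

lemma rank_ge_Suc_nonzero:
  assumes "rank_ge S (Suc n)"
  obtains v where "v \<in> S" "v \<noteq> 0"
proof -
  obtain B where B: "finite B" "mp.independent B" "B \<subseteq> mp.span S" "card B = Suc n"
    using assms by (auto simp: rank_ge_def)
  have "\<not> S \<subseteq> {0}"
  proof
    assume "S \<subseteq> {0}"
    then have "mp.span S \<subseteq> {0}" using mp.span_mono[of S "{0}"] mp.span_insert_0[of "{}"] by simp
    then have "B \<subseteq> {0}" using B(3) by blast
    moreover have "0 \<notin> B" using B(2) mp.dependent_zero by blast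
    ultimately have "B = {}" by blast
    then show False using B(4) by simp
  qed
  then show ?thesis using that by blast
qed

text \<open>Gaussian elimination without division. Choose a pivot \<open>v\<^sub>m\<close> that is nonzero at \<open>F0\<close> and replace every
  \<open>w\<close> by \<open>v\<^sub>m w - w\<^sub>m v\<close>; the entries remain polynomial functions, and the rank at \<open>F0\<close> drops by at most
  one. Conversely, wherever \<open>v\<^sub>m\<close> does not vanish, \<open>v\<close> is independent of the new vectors, whose
  coefficient at \<open>m\<close> is zero. The required function is the product of all pivots.\<close>

lemma rank_ge_polyfun_open:
  fixes vs :: "((nat \<Rightarrow> ('v, 'k::field) mpoly) \<Rightarrow> ('v, 'k) mpoly) list"
  assumes "\<And>v m. v \<in> set vs \<Longrightarrow> polyfun d r (\<lambda>F. Poly_Mapping.lookup (v F) m)"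
    and "rank_ge ((\<lambda>v. v F0) ` set vs) n"
  shows "\<exists>f. polyfun d r f \<and> f F0 \<noteq> 0 \<and> (\<forall>F. f F \<noteq> 0 \<longrightarrow> rank_ge ((\<lambda>v. v F) ` set vs) n)"
  using assms
proof (induction n arbitrary: vs)
  case 0
  have "rank_ge S 0" for S :: "('v, 'k) mpoly set"
    unfolding rank_ge_def by (intro exI[of _ "{}"]) (auto simp: mp.independent_empty)
  then show ?case by (intro exI[of _ "\<lambda>_. 1"]) (auto intro: polyfun_const)
next
  case (Suc n)
  obtain v where v: "v \<in> set vs" "v F0 \<noteq> 0"
    using rank_ge_Suc_nonzero[OF Suc.prems(2)] by blast
  then obtain m where m: "Poly_Mapping.lookup (v F0) m \<noteq> 0"
    by (metis lookup_zero poly_mapping_eqI)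
  define red where "red w = (\<lambda>F. const_poly (Poly_Mapping.lookup (v F) m) * w F
      - const_poly (Poly_Mapping.lookup (w F) m) * v F)" for w
  have red_m: "Poly_Mapping.lookup (red w F) m = 0" for w F
    by (simp add: red_def lookup_minus)
  have polys: "polyfun d r (\<lambda>F. Poly_Mapping.lookup (red w F) m')" if "w \<in> set vs" for w m'
    unfolding red_def using that v(1) Suc.prems(1)
    by (simp add: lookup_minus polyfun_diff polyfun_mult)
  have "rank_ge (insert (v F0) ((\<lambda>w. w F0) ` set (map red vs))) (Suc n)" (is "rank_ge ?R _")
  proof (rule rank_ge_mono[OF Suc.prems(2)], clarify)
    fix w assume w: "w \<in> set vs"
    let ?c = "Poly_Mapping.lookup (v F0) m" and ?e = "Poly_Mapping.lookup (w F0) m"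
    have "const_poly (inverse ?c) * (red w F0 + const_poly ?e * v F0) \<in> mp.span ?R"
      using w by (intro mp.span_scale mp.span_add) (auto intro: mp.span_base)
    also have "const_poly (inverse ?c) * (red w F0 + const_poly ?e * v F0) = w F0"
      using m by (intro poly_mapping_eqI) (simp add: red_def lookup_add lookup_minus)
    finally show "w F0 \<in> mp.span ?R" .
  qed
  then have "rank_ge ((\<lambda>w. w F0) ` set (map red vs)) n" by (rule rank_ge_insertD[rotated]) simp
  then obtain f where f: "polyfun d r f" "f F0 \<noteq> 0"
      "\<And>F. f F \<noteq> 0 \<Longrightarrow> rank_ge ((\<lambda>w. w F) ` set (map red vs)) n"
    using Suc.IH[of "map red vs"] polys by auto
  have "rank_ge ((\<lambda>v. v F) ` set vs) (Suc n)" if nz: "f F * Poly_Mapping.lookup (v F) m \<noteq> 0" for F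
  proof -
    let ?R = "(\<lambda>w. w F) ` set (map red vs)"
    have "v F \<notin> mp.span ?R"
      using span_lookup_eq_0[of ?R m "v F"] red_m nz by auto
    then have "rank_ge (insert (v F) ?R) (Suc n)"
      using f(3) nz by (intro rank_ge_insert) auto
    moreover have "insert (v F) ?R \<subseteq> mp.span ((\<lambda>v. v F) ` set vs)"
      using v(1) by (auto simp: red_def intro!: mp.span_diff mp.span_scale intro: mp.span_base)
    ultimately show ?thesis by (rule rank_ge_mono)
  qed
  moreover have "polyfun d r (\<lambda>F. f F * Poly_Mapping.lookup (v F) m)"
    using f(1) v(1) Suc.prems(1) by (intro polyfun_mult) auto
  ultimately show ?case
    using f(2) m by (intro exI[of _ "\<lambda>F. f F * Poly_Mapping.lookup (v F) m"]) auto
qed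

lemma gens_cong: "(\<And>i. i \<in> {1..r} \<Longrightarrow> F i = G i) \<Longrightarrow> gens F r d j = gens G r d j"
  by (auto simp: gens_def intro!: Collect_cong) (metis Suc_le_eq)+

text \<open>Tuples of fewer than four forms are completed by fixed forms \<open>c\<close> when they are compared with
  complete intersections.\<close>

definition extend_tuple :: "nat \<Rightarrow> (nat \<Rightarrow> 'a) \<Rightarrow> (nat \<Rightarrow> 'a) \<Rightarrow> nat \<Rightarrow> 'a" where
  "extend_tuple r c F i = (if i \<le> r then F i else c i)"

text \<open>An instance of \<open>rank_ge_polyfun_open\<close>. The components of a tuple are replaced by their parts of degree
  \<open>d\<close>, which changes nothing on \<open>form_tuples d r\<close> and makes all entries polynomial functions in the sense
  of \<open>polyfun\<close>.\<close>

lemma generic_rank_ge: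
  fixes c G :: "nat \<Rightarrow> ('v::finite, 'k::field_char_0) mpoly"
  assumes G: "\<And>i. i \<in> {1..r} \<Longrightarrow> G i \<in> forms d"
    and c: "\<And>i. i \<in> {r<..s} \<Longrightarrow> c i \<in> forms d"
    and rank: "rank_ge (gens (extend_tuple r c G) s d j) n"
  shows "generic d r (\<lambda>F. rank_ge (gens (extend_tuple r c F) s d j) n)"
proof -
  let ?A = "{a :: 'v \<Rightarrow>\<^sub>0 nat. mon_degree a + d = j}"
  have "finite ?A" by (rule finite_subset[OF _ finite_monomials[of "j - d"]]) auto
  then obtain xs where xs: "set xs = {1..s} \<times> ?A" using finite_list[of "{1..s} \<times> ?A"] by auto
  define vs :: "((nat \<Rightarrow> ('v, 'k) mpoly) \<Rightarrow> ('v, 'k) mpoly) list" where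
    "vs = map (\<lambda>(i, a) F. xmon a * hproj d (extend_tuple r c F i)) xs"
  have ev: "(\<lambda>v. v F) ` set vs = gens (extend_tuple r c F) s d j" if F: "F \<in> form_tuples d r" for F
  proof -
    have p: "hproj d (extend_tuple r c F i) = extend_tuple r c F i" if "i \<in> {1..s}" for i
    proof -
      have "extend_tuple r c F i \<in> forms d"
        using that F c by (auto simp: extend_tuple_def form_tuples_def)
      then show ?thesis using hproj_forms[of "extend_tuple r c F i" d d] by simp
    qed
    have "(\<lambda>v. v F) ` set vs = (\<lambda>(i, a). xmon a * hproj d (extend_tuple r c F i)) ` ({1..s} \<times> ?A)"
      unfolding xs[symmetric] by (simp add: vs_def image_image case_prod_beta)
    also have "\<dots> = (\<lambda>(i, a). xmon a * extend_tuple r c F i) ` ({1..s} \<times> ?A)"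
      by (intro image_cong refl) (auto simp: p)
    also have "\<dots> = gens (extend_tuple r c F) s d j"
      unfolding gens_def by (auto simp del: atLeastAtMost_iff)
    finally show ?thesis .
  qed
  let ?G = "restrict G {1..r}"
  have Gt: "?G \<in> form_tuples d r" using G by (auto simp: form_tuples_def)
  have "gens (extend_tuple r c ?G) s d j = gens (extend_tuple r c G) s d j"
    by (intro gens_cong) (auto simp: extend_tuple_def)
  then have "rank_ge ((\<lambda>v. v ?G) ` set vs) n" using rank ev[OF Gt] by simp
  moreover have "polyfun d r (\<lambda>F. Poly_Mapping.lookup (v F) m)" if "v \<in> set vs" for v m
  proof -
    have "v \<in> (\<lambda>(i, a) F. xmon a * hproj d (extend_tuple r c F i)) ` set xs"
      using that by (simp add: vs_def)
    then obtain ia where ia: "v = (case ia of (i, a) \<Rightarrow> \<lambda>F. xmon a * hproj d (extend_tuple r c F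
        i))" "ia \<in> set xs"
      by (rule imageE)
    obtain i a where "ia = (i, a)" by (cases ia)
    with ia have v: "v = (\<lambda>F. xmon a * hproj d (extend_tuple r c F i))" "(i, a) \<in> set xs" by
        simp_all
    then have i: "i \<ge> 1" by (simp add: xs)
    show ?thesis
      using i unfolding v(1) lookup_single_mult lookup_hproj
      by (cases "\<exists>b. m = a + b"; cases "mon_degree (m - a) = d"; cases "i \<le> r")
        (auto simp: extend_tuple_def intro: polyfun_const polyfun_coord)
  qed
  ultimately obtain f where f: "polyfun d r f" "f ?G \<noteq> 0"
      "\<And>F. f F \<noteq> 0 \<Longrightarrow> rank_ge ((\<lambda>v. v F) ` set vs) n"
    using rank_ge_polyfun_open[of vs d r ?G n] by blast
  have "rank_ge (gens (extend_tuple r c F) s d j) n" if "F \<in> form_tuples d r" "f F \<noteq> 0" for F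
    using f(3)[OF that(2)] unfolding ev[OF that(1)] .
  then show ?thesis unfolding generic_def using f(1,2) Gt by blast
qed

section \<open>Counting monomials\<close>

lemma card_monomials:
  "card {a :: 'v::finite \<Rightarrow>\<^sub>0 nat. mon_degree a = j} = (j + CARD('v) - 1) choose j"
proof -
  obtain vs :: "'v list" where vs: "set vs = UNIV" "distinct vs"
    using finite_distinct_list[OF finite[of UNIV]] by blast
  have len: "length vs = CARD('v)" using distinct_card[OF vs(2)] vs(1) by simp
  let ?f = "\<lambda>a :: 'v \<Rightarrow>\<^sub>0 nat. map (Poly_Mapping.lookup a) vs"
  have sum: "sum_list (?f a) = mon_degree a" for a
    using vs by (simp add: mon_degree_superset[of UNIV] sum_list_distinct_conv_sum_set)
  have "bij_betw ?f {a. mon_degree a = j} {l. length l = CARD('v) \<and> sum_list l = j}"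
  proof (rule bij_betwI')
    fix a b :: "'v \<Rightarrow>\<^sub>0 nat"
    show "(?f a = ?f b) = (a = b)" using vs(1) by (auto intro: poly_mapping_eqI)
  next
    fix a :: "'v \<Rightarrow>\<^sub>0 nat" assume "a \<in> {a. mon_degree a = j}"
    then show "?f a \<in> {l. length l = CARD('v) \<and> sum_list l = j}" using len sum by simp
  next
    fix l :: "nat list" assume l: "l \<in> {l. length l = CARD('v) \<and> sum_list l = j}"
    let ?a = "Abs_poly_mapping (\<lambda>v. the (map_of (zip vs l) v)) :: 'v \<Rightarrow>\<^sub>0 nat"
    have "?f ?a = l"
    proof (rule nth_equalityI)
      fix i assume "i < length (?f ?a)"
      then have i: "i < length vs" by simp
      then have "map_of (zip vs l) (vs ! i) = Some (l ! i)"
        using vs(2) l len by (intro map_of_zip_nth) auto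
      then show "?f ?a ! i = l ! i" using i by simp
    qed (use l len in simp)
    then show "\<exists>a\<in>{a. mon_degree a = j}. l = ?f a"
      using l sum[of ?a] by (intro bexI[of _ ?a]) auto
  qed
  then show ?thesis
    using card_length_sum_list[of "CARD('v)" j] by (simp add: bij_betw_same_card)
qed

text \<open>Bounding the exponent of one more variable \<open>v\<close> removes the monomials divisible by \<open>v\<^sup>d\<close>, and division
  by \<open>v\<^sup>d\<close> matches these with the monomials of degree \<open>j - d\<close>. This is the Hilbert function of the ideal
  generated by the \<open>d\<close>-th powers of the variables in \<open>A\<close>.\<close>

lemma card_bounded_monomials:
  assumes "finite A" "d > 0"
  shows "int (card {a :: 'v::finite \<Rightarrow>\<^sub>0 nat. mon_degree a = j \<and> (\<forall>v\<in>A. Poly_Mapping.lookup a v <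
      d)}) =
    iterated_difference d (\<lambda>j. int (card {a :: 'v \<Rightarrow>\<^sub>0 nat. mon_degree a = j})) (card A) j"
  using assms(1)
proof (induction A arbitrary: j rule: finite_induct)
  case (insert v A)
  let ?N = "\<lambda>A j. {a :: 'v \<Rightarrow>\<^sub>0 nat. mon_degree a = j \<and> (\<forall>v\<in>A. Poly_Mapping.lookup a v < d)}"
  have fin: "finite (?N A j)" for A j
    by (rule finite_subset[OF _ finite_monomials[of j]]) auto
  let ?x = "Poly_Mapping.single v d :: 'v \<Rightarrow>\<^sub>0 nat"
  have un: "?N A j = ?N (insert v A) j \<union> (if d \<le> j then (+) ?x ` ?N A (j - d) else {})" (is "_ = _
      \<union> ?R")
  proof (intro equalityI subsetI)
    fix a assume a: "a \<in> ?N A j"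
    show "a \<in> ?N (insert v A) j \<union> ?R"
    proof (cases "Poly_Mapping.lookup a v < d")
      case False
      then have eq: "a = ?x + (a - ?x)"
        by (intro poly_mapping_eqI) (auto simp: lookup_add lookup_minus lookup_single when_def)
      then have deg: "mon_degree a = d + mon_degree (a - ?x)"
        by (metis mon_degree_add mon_degree_single)
      have "Poly_Mapping.lookup (a - ?x) u \<le> Poly_Mapping.lookup a u" for u
        by (simp add: lookup_minus)
      then have "a - ?x \<in> ?N A (j - d)" "d \<le> j"
        using a deg by (auto intro: le_less_trans)
      then show ?thesis using eq by auto
    qed (use a in auto)
  next
    fix a assume "a \<in> ?N (insert v A) j \<union> ?R"
    then show "a \<in> ?N A j"
    proof
      assume "a \<in> ?R"
      then obtain b where b: "a = ?x + b" "b \<in> ?N A (j - d)" "d \<le> j" by (auto split: if_splits)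
      have "Poly_Mapping.lookup a u = Poly_Mapping.lookup b u" if "u \<in> A" for u
        using that insert(2) b(1) by (auto simp: lookup_add lookup_single when_def)
      then show ?thesis using b by (auto simp: mon_degree_add)
    qed auto
  qed
  have disj: "?N (insert v A) j \<inter> ?R = {}" by (auto simp: lookup_add)
  have cR: "card ?R = (if d \<le> j then card (?N A (j - d)) else 0)"
    by (auto simp: card_image)
  have "finite ?R" using fin by auto
  then have "card (?N (insert v A) j \<union> ?R) = card (?N (insert v A) j) + card ?R"
    by (rule card_Un_disjoint[OF fin _ disj])
  then have "card (?N A j) = card (?N (insert v A) j) + (if d \<le> j then card (?N A (j - d)) else 0)"
    unfolding un[symmetric] cR .
  then have "int (card (?N (insert v A) j)) = int (card (?N A j)) - (if d \<le> j then int (card (?N A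
      (j - d))) else 0)"
    by auto
  then show ?case using insert by simp
qed simp

section \<open>Ranks modulo two\<close>

definition sym_diff_list :: "'a list \<Rightarrow> 'a list \<Rightarrow> 'a list" where
  "sym_diff_list xs ys = filter (\<lambda>x. x \<notin> set ys) xs @ filter (\<lambda>y. y \<notin> set xs) ys"

text \<open>Gaussian elimination over the field with two elements. A row is the list of the positions of its
  ones, its first entry serves as the pivot, and addition of rows is symmetric difference.\<close>

fun parity_rank :: "'a list list \<Rightarrow> nat" where
  "parity_rank [] = 0"
| "parity_rank ([] # rs) = parity_rank rs"
| "parity_rank ((c # r) # rs) =
     1 + parity_rank (map (\<lambda>s. if c \<in> set s then sym_diff_list s (c # r) else s) rs)"

text \<open>The row \<open>s\<close> remembers of the coefficients of \<open>p\<close> in the columns \<open>C\<close> only their parities. The integers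
  themselves would grow quickly during an elimination without division.\<close>

definition parity_support ::
    "('c \<Rightarrow> 'v \<Rightarrow>\<^sub>0 nat) \<Rightarrow> 'c set \<Rightarrow> ('v, 'k::field) mpoly \<Rightarrow> 'c list \<Rightarrow> bool" where
  "parity_support e C p s \<longleftrightarrow> set s \<subseteq> C \<and>
     (\<forall>c\<in>C. \<exists>z::int. Poly_Mapping.lookup p (e c) = of_int z \<and> (odd z \<longleftrightarrow> c \<in> set s))"

lemma parity_support_eliminate:
  assumes v: "parity_support e C v (c # r)" and p: "parity_support e C p s"
  shows "parity_support e C
    (const_poly (Poly_Mapping.lookup v (e c)) * p - const_poly (Poly_Mapping.lookup p (e c)) * v)
    (if c \<in> set s then sym_diff_list s (c # r) else s)" (is "parity_support e C ?q ?t")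
  unfolding parity_support_def
proof (intro conjI ballI)
  show "set ?t \<subseteq> C"
    using v p by (auto simp: parity_support_def sym_diff_list_def)
  fix c' assume c': "c' \<in> C"
  have c: "c \<in> C" using v by (simp add: parity_support_def)
  obtain x where x: "Poly_Mapping.lookup v (e c) = of_int x" "odd x"
    using v c unfolding parity_support_def by force
  obtain y where y: "Poly_Mapping.lookup p (e c) = of_int y" "odd y \<longleftrightarrow> c \<in> set s"
    using p c unfolding parity_support_def by blast
  obtain x' where x': "Poly_Mapping.lookup v (e c') = of_int x'" "odd x' \<longleftrightarrow> c' \<in> set (c # r)"
    using v c' unfolding parity_support_def by blast
  obtain y' where y': "Poly_Mapping.lookup p (e c') = of_int y'" "odd y' \<longleftrightarrow> c' \<in> set s"
    using p c' unfolding parity_support_def by blast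
  have "Poly_Mapping.lookup ?q (e c') = of_int (x * y' - y * x')"
    using x y x' y' by (simp add: lookup_minus)
  moreover have "odd (x * y' - y * x') \<longleftrightarrow> c' \<in> set ?t"
    using x(2) y(2) x'(2) y'(2) by (auto simp: sym_diff_list_def)
  ultimately show "\<exists>z. Poly_Mapping.lookup ?q (e c') = of_int z \<and> (odd z \<longleftrightarrow> c' \<in> set ?t)"
    by blast
qed

text \<open>The elimination modulo two is shadowed by one over the integers, in which \<open>p\<close> is replaced by
  \<open>v\<^sub>c p - p\<^sub>c v\<close>. Since the pivot \<open>v\<^sub>c\<close> is odd, the parities of the new row are those of \<open>p\<close> or of \<open>p + v\<close>,
  according to the parity of \<open>p\<^sub>c\<close>; and being odd, the pivot is nonzero in characteristic zero. The set \<open>S\<close>,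
  whose coefficients in the columns \<open>C\<close> are zero, allows several blocks with disjoint columns to be treated in turn.\<close>

lemma parity_rank_sound:
  fixes ps :: "('v, 'k::field_char_0) mpoly list"
  assumes "list_all2 (parity_support e C) ps ss"
    and S: "rank_ge S n" "\<And>p c. p \<in> S \<Longrightarrow> c \<in> C \<Longrightarrow> Poly_Mapping.lookup p (e c) = 0"
  shows "rank_ge (S \<union> set ps) (n + parity_rank ss)"
  using assms(1)
proof (induction ss arbitrary: ps rule: parity_rank.induct)
  case 1
  then show ?case using S by simp
next
  case (2 rs)
  then obtain p ps' where ps: "ps = p # ps'" "list_all2 (parity_support e C) ps' rs"
    by (auto simp: list_all2_Cons2)
  have "S \<union> set ps' \<subseteq> mp.span (S \<union> set ps)" using ps(1) by (auto intro: mp.span_base)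
  then have "rank_ge (S \<union> set ps) (n + parity_rank rs)"
    by (rule rank_ge_mono[OF "2.IH"[OF ps(2)]])
  then show ?case by simp
next
  case (3 c r rs)
  then obtain v ps' where ps: "ps = v # ps'" "parity_support e C v (c # r)"
      "list_all2 (parity_support e C) ps' rs"
    by (auto simp: list_all2_Cons2)
  let ?red = "\<lambda>p. const_poly (Poly_Mapping.lookup v (e c)) * p - const_poly (Poly_Mapping.lookup p
      (e c)) * v"
  let ?ps = "map ?red ps'" and ?n = "parity_rank (map (\<lambda>s. if c \<in> set s then sym_diff_list s (c #
      r) else s) rs)"
  have c: "c \<in> C" using ps(2) by (simp add: parity_support_def)
  obtain x where x: "Poly_Mapping.lookup v (e c) = of_int x" "odd x"
    using ps(2) c unfolding parity_support_def by force
  have "list_all2 (parity_support e C) ?ps (map (\<lambda>s. if c \<in> set s then sym_diff_list s (c # r)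
      else s) rs)"
    unfolding list_all2_map1 list_all2_map2
    using ps(3) by (rule list_all2_mono) (rule parity_support_eliminate[OF ps(2)])
  then have "rank_ge (S \<union> set ?ps) (n + ?n)" by (rule "3.IH")
  moreover have "v \<notin> mp.span (S \<union> set ?ps)"
  proof
    assume "v \<in> mp.span (S \<union> set ?ps)"
    then have "Poly_Mapping.lookup v (e c) = 0"
      by (rule span_lookup_eq_0[rotated]) (use S(2) c in \<open>auto simp: lookup_minus\<close>)
    then show False using x by auto
  qed
  ultimately have "rank_ge (insert v (S \<union> set ?ps)) (Suc (n + ?n))" by (rule rank_ge_insert)
  moreover have "insert v (S \<union> set ?ps) \<subseteq> mp.span (S \<union> set ps)"
    using ps(1) by (auto intro!: mp.span_diff mp.span_scale intro: mp.span_base)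
  ultimately have "rank_ge (S \<union> set ps) (Suc (n + ?n))" by (rule rank_ge_mono)
  then show ?case by simp
qed

section \<open>Forms in four variables that are homogeneous for a second grading\<close>

text \<open>Exponent vectors in four variables, in a form suitable for evaluation.\<close>

type_synonym quad = "nat \<times> nat \<times> nat \<times> nat"

definition var :: "nat \<Rightarrow> 4" where
  "var = (SOME h. bij_betw h {..<4} UNIV)"

lemma bij_var: "bij_betw var {..<4} UNIV"
proof -
  have "\<exists>h :: nat \<Rightarrow> 4. bij_betw h {..<4} UNIV"
    by (rule finite_same_card_bij) auto
  then show ?thesis unfolding var_def by (rule someI_ex)
qed

fun exps :: "quad \<Rightarrow> (4 \<Rightarrow>\<^sub>0 nat)" where
  "exps (a, b, c, e) = Poly_Mapping.single (var 0) a + Poly_Mapping.single (var 1) b +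
     Poly_Mapping.single (var 2) c + Poly_Mapping.single (var 3) e"

fun quad_add :: "quad \<Rightarrow> quad \<Rightarrow> quad" where
  "quad_add (a, b, c, e) (a', b', c', e') = (a + a', b + b', c + c', e + e')"

fun quad_degree :: "quad \<Rightarrow> nat" where
  "quad_degree (a, b, c, e) = a + b + c + e"

fun in_box :: "nat \<Rightarrow> quad \<Rightarrow> bool" where
  "in_box d (a, b, c, e) \<longleftrightarrow> a < d \<and> b < d \<and> c < d \<and> e < d"

text \<open>The second grading: the variables receive the weights \<open>p, q, r, s\<close> in \<open>\<int>/m\<close>.\<close>

fun weight :: "nat \<Rightarrow> quad \<Rightarrow> quad \<Rightarrow> nat" where
  "weight m (p, q, r, s) (a, b, c, e) = (p * a + q * b + r * c + s * e) mod m"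

lemma var_eq_iff: "i < 4 \<Longrightarrow> k < 4 \<Longrightarrow> var i = var k \<longleftrightarrow> i = k"
  using bij_var unfolding bij_betw_def inj_on_def by auto

lemma lookup_exps:
  "Poly_Mapping.lookup (exps (a, b, c, e)) (var 0) = a"
  "Poly_Mapping.lookup (exps (a, b, c, e)) (var 1) = b"
  "Poly_Mapping.lookup (exps (a, b, c, e)) (var 2) = c"
  "Poly_Mapping.lookup (exps (a, b, c, e)) (var 3) = e"
  by (simp_all add: lookup_add lookup_single var_eq_iff)

lemma all_var: "(\<forall>v. P v) \<longleftrightarrow> P (var 0) \<and> P (var 1) \<and> P (var 2) \<and> P (var 3)"
proof -
  have "UNIV = var ` {..<4}" using bij_var unfolding bij_betw_def by simp
  also have "{..<4} = {0, 1, 2, 3 :: nat}" by auto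
  finally have "UNIV = {var 0, var 1, var 2, var 3}" by simp
  then show ?thesis by (metis UNIV_I empty_iff insert_iff)
qed

lemma inj_exps: "inj exps"
proof (rule injI)
  fix p q assume "exps p = exps q"
  moreover obtain a b c e where p: "p = (a, b, c, e)" by (cases p)
  moreover obtain a' b' c' e' where q: "q = (a', b', c', e')" by (cases q)
  ultimately show "p = q" using lookup_exps[of a b c e] lookup_exps[of a' b' c' e'] by auto
qed

lemma exps_eq_iff: "exps p = exps q \<longleftrightarrow> p = q"
  using inj_exps by (auto dest: injD)

lemma exps_add: "exps (quad_add p q) = exps p + exps q"
  by (cases p; cases q) (simp add: single_add ac_simps)

lemma mon_degree_exps [simp]: "mon_degree (exps q) = quad_degree q"
  by (cases q) (simp add: mon_degree_add)

lemma in_box_iff: "in_box d q \<longleftrightarrow> (\<forall>v. Poly_Mapping.lookup (exps q) v < d)"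
  unfolding all_var by (cases q) (simp add: lookup_exps del: exps.simps One_nat_def)

lemma weight_add: "weight m W (quad_add p q) = (weight m W p + weight m W q) mod m"
  by (cases W; cases p; cases q) (simp add: mod_add_eq algebra_simps)

definition support_form :: "quad list \<Rightarrow> (4, 'k::field) mpoly" where
  "support_form f = (\<Sum>q\<in>set f. xmon (exps q))"

lemma lookup_support_form: "Poly_Mapping.lookup (support_form f) (exps c) = (if c \<in> set f then 1
    else 0)"
  unfolding support_form_def lookup_sum lookup_single when_def by (simp add: exps_eq_iff)

lemma lookup_shifted_support_form:
  "Poly_Mapping.lookup (xmon (exps a) * support_form f :: (4, 'k::field) mpoly) (exps c) = (if c \<in>
      quad_add a ` set f then 1 else 0)"
proof -
  have "xmon (exps a) * support_form f = (\<Sum>q\<in>set f. xmon (exps (quad_add a q)) :: (4, 'k) mpoly)"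
    by (simp add: support_form_def sum_distrib_left mult_single exps_add)
  also have "\<dots> = support_form (map (quad_add a) f)"
  proof -
    have "inj_on (quad_add a) (set f)"
      by (rule inj_onI) (metis exps_add exps_eq_iff add_left_cancel)
    then show ?thesis unfolding support_form_def by (simp add: sum.reindex)
  qed
  finally show ?thesis by (simp add: lookup_support_form)
qed

lemma support_form_in_forms:
  "\<forall>q\<in>set f. quad_degree q = d \<Longrightarrow> support_form f \<in> forms d"
  unfolding support_form_def by (intro mp.subspace_sum[OF subspace_forms]) (simp add: forms_def)

definition box_quads :: "nat \<Rightarrow> nat \<Rightarrow> quad list" where
  "box_quads d n = concat (map (\<lambda>a. concat (map (\<lambda>b. concat (map (\<lambda>c.
     if a + b + c \<le> n \<and> n < a + b + c + d then [(a, b, c, n - (a + b + c))] else [])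
     [0..<d])) [0..<d])) [0..<d])"

text \<open>The rows \<open>x\<^sup>a f\<close> of total weight \<open>w\<close>, restricted to the box. The lists \<open>ms\<close> and \<open>fs\<close> contain the
  multipliers \<open>a\<close> and the forms \<open>f\<close>, each together with its weight.\<close>

definition block_rows ::
    "nat \<Rightarrow> nat \<Rightarrow> (nat \<times> quad) list \<Rightarrow> (nat \<times> quad list) list \<Rightarrow> nat \<Rightarrow> quad list list" where
  "block_rows d m ms fs w = concat (map (\<lambda>(v, f). let t = (w + m - v) mod m in
     map (\<lambda>(u, a). filter (in_box d) (map (quad_add a) f)) (filter (\<lambda>(u, a). u = t) ms)) fs)"

definition sum_of_block_ranks ::
    "nat \<Rightarrow> nat \<Rightarrow> (nat \<times> quad) list \<Rightarrow> (nat \<times> quad list) list \<Rightarrow> nat" where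
  "sum_of_block_ranks d m ms fs = sum_list (map (\<lambda>w. parity_rank (block_rows d m ms fs w)) [0..<m])"

text \<open>The rank modulo two of multiplication by the forms \<open>fs\<close> from degree \<open>e\<close> to the box in degree
  \<open>d + e\<close>, as the sum over the weights. The weights of multipliers and forms are passed on as arguments so
  that they are computed only once.\<close>

definition weighted_rank :: "nat \<Rightarrow> nat \<Rightarrow> nat \<Rightarrow> quad \<Rightarrow> quad list list \<Rightarrow> nat" where
  "weighted_rank d e m W fs = sum_of_block_ranks d m
     (map (\<lambda>a. (weight m W a, a)) (box_quads d e)) (map (\<lambda>f. (weight m W (hd f), f)) fs)"

definition weighted_forms :: "nat \<Rightarrow> nat \<Rightarrow> quad \<Rightarrow> quad list list \<Rightarrow> bool" where
  "weighted_forms d m W fs \<longleftrightarrow>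
     list_all (\<lambda>f. list_all (\<lambda>q. quad_degree q = d \<and> weight m W q = weight m W (hd f)) f) fs"

lemma box_quads_degree: "q \<in> set (box_quads d n) \<Longrightarrow> quad_degree q = n"
  by (auto simp: box_quads_def split: if_splits)

lemma list_all2_choice:
  assumes "\<And>s. s \<in> set ss \<Longrightarrow> \<exists>p\<in>G. R p s"
  obtains ps where "set ps \<subseteq> G" "list_all2 R ps ss"
proof -
  have "\<exists>ps. set ps \<subseteq> G \<and> list_all2 R ps ss"
    using assms
  proof (induction ss)
    case (Cons s ss)
    obtain p where "p \<in> G" "R p s" using Cons.prems by auto
    moreover obtain ps where "set ps \<subseteq> G" "list_all2 R ps ss" using Cons by auto
    ultimately show ?case by (intro exI[of _ "p # ps"]) auto
  qed simp
  then show ?thesis using that by blast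
qed

definition block_polys ::
    "nat \<Rightarrow> nat \<Rightarrow> quad \<Rightarrow> quad list list \<Rightarrow> nat \<Rightarrow> (4, 'k::field) mpoly set" where
  "block_polys e m W fs w = {xmon (exps a) * support_form f | a f. f \<in> set fs \<and> quad_degree a = e \<and>
     (weight m W a + weight m W (hd f)) mod m = w}"

lemma weight_in_block:
  assumes fs: "weighted_forms d m W fs" and p: "p \<in> block_polys e m W fs w"
    and c: "Poly_Mapping.lookup p (exps c) \<noteq> 0"
  shows "weight m W c = w"
proof -
  obtain a f where af: "p = xmon (exps a) * support_form f" "f \<in> set fs"
      "(weight m W a + weight m W (hd f)) mod m = w"
    using p by (auto simp: block_polys_def)
  have "c \<in> quad_add a ` set f"
    using c unfolding af(1) lookup_shifted_support_form by (simp split: if_splits)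
  then obtain q where q: "c = quad_add a q" "q \<in> set f" by blast
  then have "weight m W q = weight m W (hd f)"
    using fs af(2) by (auto simp: weighted_forms_def list_all_iff)
  then show ?thesis using q af(3) by (simp add: weight_add)
qed

lemma parity_support_block:
  assumes fs: "weighted_forms d' m W fs" and w: "w < m"
    and s: "s \<in> set (block_rows d m (map (\<lambda>a. (weight m W a, a)) (box_quads d e))
      (map (\<lambda>f. (weight m W (hd f), f)) fs) w)"
  shows "\<exists>p\<in>block_polys e m W fs w. parity_support exps {c. in_box d c \<and> weight m W c = w} p s"
proof -
  obtain f a where f: "f \<in> set fs" and a: "a \<in> set (box_quads d e)"
      and wa: "weight m W a = (w + m - weight m W (hd f)) mod m"
      and sa: "s = filter (in_box d) (map (quad_add a) f)"
    using s by (auto simp: block_rows_def Let_def)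
  have "weight m W (hd f) < m"
    using w by (cases W; cases "hd f") simp
  then have "(weight m W a + weight m W (hd f)) mod m = w"
    unfolding wa using w by (simp add: mod_add_left_eq)
  then have p: "xmon (exps a) * support_form f \<in> block_polys e m W fs w"
    using f box_quads_degree[OF a] unfolding block_polys_def by blast
  have "set s \<subseteq> {c. in_box d c \<and> weight m W c = w}"
  proof
    fix c assume c: "c \<in> set s"
    then have "Poly_Mapping.lookup (xmon (exps a) * support_form f :: (4, rat) mpoly) (exps c) \<noteq> 0"
      unfolding lookup_shifted_support_form using sa by auto
    moreover have "xmon (exps a) * support_form f \<in> (block_polys e m W fs w :: (4, rat) mpoly set)"
      using f box_quads_degree[OF a] \<open>(weight m W a + weight m W (hd f)) mod m = w\<close>
      unfolding block_polys_def by blast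
    ultimately have "weight m W c = w" using weight_in_block[OF fs] by blast
    then show "c \<in> {c. in_box d c \<and> weight m W c = w}" using c sa by simp
  qed
  moreover have "\<exists>z::int. Poly_Mapping.lookup (xmon (exps a) * support_form f) (exps c) = of_int z
      \<and> (odd z \<longleftrightarrow> c \<in> set s)"
    if "in_box d c" for c
    using that by (intro exI[of _ "if c \<in> quad_add a ` set f then 1 else 0"])
      (auto simp: lookup_shifted_support_form sa)
  ultimately have "parity_support exps {c. in_box d c \<and> weight m W c = w} (xmon (exps a) *
      support_form f) s"
    unfolding parity_support_def by blast
  then show ?thesis using p by blast
qed

definition non_box_monomials :: "nat \<Rightarrow> nat \<Rightarrow> (4 \<Rightarrow>\<^sub>0 nat) set" where
  "non_box_monomials d j = {a. mon_degree a = j \<and> \<not> (\<forall>v. Poly_Mapping.lookup a v < d)}"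

lemma finite_non_box_monomials: "finite (non_box_monomials d j)"
  unfolding non_box_monomials_def by (rule finite_subset[OF _ finite_monomials[of j]]) auto

text \<open>The blocks are treated one weight after the other. The products of one weight have
  coefficient zero at the monomials of all other weights, and so do the monomials outside the box at those
  inside. Hence
  \<open>parity_rank_sound\<close> applies to each block on top of everything before it.\<close>

lemma rank_of_blocks:
  assumes fs: "weighted_forms d m W fs"
  shows "rank_ge (xmon ` non_box_monomials d j \<union> (\<Union>w<m. block_polys e m W fs w) :: (4,
      'k::field_char_0) mpoly set)
    (card (non_box_monomials d j) + weighted_rank d e m W fs)"
proof -
  define rows where "rows = block_rows d m (map (\<lambda>a. (weight m W a, a)) (box_quads d e))
      (map (\<lambda>f. (weight m W (hd f), f)) fs)"
  let ?B = "\<lambda>w. block_polys e m W fs w :: (4, 'k) mpoly set"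
  let ?N = "xmon ` non_box_monomials d j :: (4, 'k) mpoly set"
  have "rank_ge (?N \<union> (\<Union>w<k. ?B w))
      (card (non_box_monomials d j) + sum_list (map (\<lambda>w. parity_rank (rows w)) [0..<k]))"
    if "k \<le> m" for k
    using that
  proof (induction k)
    case 0
    then show ?case using rank_ge_monoms[OF finite_non_box_monomials] by simp
  next
    case (Suc k)
    let ?C = "{c. in_box d c \<and> weight m W c = k}"
    have "\<exists>p\<in>?B k. parity_support exps ?C p s" if "s \<in> set (rows k)" for s
      using Suc.prems by (intro parity_support_block[OF fs _ that[unfolded rows_def]]) simp
    then obtain ps where ps: "set ps \<subseteq> ?B k" "list_all2 (parity_support exps ?C) ps (rows k)"
      by (rule list_all2_choice)
    have zero: "Poly_Mapping.lookup p (exps c) = 0" if p: "p \<in> ?N \<union> (\<Union>w<k. ?B w)" and c: "c \<in> ?C"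
        for p c
      using p
    proof
      assume "p \<in> ?N"
      then show ?thesis using c by (auto simp: non_box_monomials_def in_box_iff lookup_single
          when_def)
    next
      assume "p \<in> (\<Union>w<k. ?B w)"
      then show ?thesis using c weight_in_block[OF fs] by blast
    qed
    have "rank_ge (?N \<union> (\<Union>w<k. ?B w) \<union> set ps)
        (card (non_box_monomials d j) + sum_list (map (\<lambda>w. parity_rank (rows w)) [0..<k]) +
            parity_rank (rows k))"
      using Suc by (intro parity_rank_sound[OF ps(2)] zero) auto
    then have "rank_ge (?N \<union> (\<Union>w<Suc k. ?B w))
        (card (non_box_monomials d j) + sum_list (map (\<lambda>w. parity_rank (rows w)) [0..<k]) +
            parity_rank (rows k))"
      by (rule rank_ge_mono) (use ps(1) in \<open>auto simp: lessThan_Suc intro!: mp.span_base\<close>)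
    then show ?case by (simp add: add.assoc)
  qed
  from this[of m] show ?thesis
    by (simp add: weighted_rank_def sum_of_block_ranks_def rows_def)
qed

definition pure_powers :: "nat \<Rightarrow> nat \<Rightarrow> (4, 'k::field) mpoly" where
  "pure_powers d i = xmon (Poly_Mapping.single (var (i - 1)) d)"

lemma pure_powers_forms: "pure_powers d i \<in> forms d"
  by (simp add: pure_powers_def forms_def)

lemma non_box_monomials_gens:
  assumes "\<And>i. i \<in> {1..4} \<Longrightarrow> F i = pure_powers d i" "4 \<le> r"
  shows "xmon ` non_box_monomials d j \<subseteq> gens F r d j"
proof clarify
  fix a assume a: "a \<in> non_box_monomials d j"
  then obtain v where v: "d \<le> Poly_Mapping.lookup a v"
    by (auto simp: non_box_monomials_def not_less)
  have "v \<in> var ` {..<4}" using bij_var by (simp add: bij_betw_def)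
  then obtain i where i: "i < 4" "v = var i" by blast
  let ?x = "Poly_Mapping.single v d"
  have eq: "a = (a - ?x) + ?x"
    using v by (intro poly_mapping_eqI) (auto simp: lookup_add lookup_minus lookup_single when_def)
  then have "mon_degree (a - ?x) + d = j"
    using a by (metis (mono_tags, lifting) mem_Collect_eq mon_degree_add mon_degree_single
        non_box_monomials_def)
  then have "xmon (a - ?x) * F (Suc i) \<in> gens F r d j"
    using i assms(2) by (intro gensI) auto
  moreover have "xmon (a - ?x) * F (Suc i) = xmon a"
    using assms(1)[of "Suc i"] i eq by (simp add: pure_powers_def mult_single)
  ultimately show "xmon a \<in> gens F r d j" by simp
qed

section \<open>Attained ranks\<close>

text \<open>The argument of type \<open>'k itself\<close> fixes the field of coefficients.\<close>

definition attained :: "'k::field itself \<Rightarrow> nat \<Rightarrow> nat \<Rightarrow> nat \<Rightarrow> nat \<Rightarrow> bool" where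
  "attained _ d r j n \<longleftrightarrow> (\<exists>F :: nat \<Rightarrow> (4, 'k) mpoly. (\<forall>i\<in>{1..r}. F i \<in> forms d) \<and> rank_ge (gens F r
      d j) n)"

lemma attained_witness:
  assumes fs: "weighted_forms d m W fs" and r: "r = 4 + length fs"
  shows "attained TYPE('k::field_char_0) d r (d + e)
    (card (non_box_monomials d (d + e)) + weighted_rank d e m W fs)"
proof -
  let ?F = "\<lambda>i. if i \<le> 4 then pure_powers d i else support_form (fs ! (i - 5)) :: (4, 'k) mpoly"
  have "?F i \<in> forms d" if "i \<in> {1..r}" for i
  proof (cases "i \<le> 4")
    case False
    then have "fs ! (i - 5) \<in> set fs" using that r by auto
    then have "support_form (fs ! (i - 5)) \<in> (forms d :: (4, 'k) mpoly set)"
      using fs by (intro support_form_in_forms) (auto simp: weighted_forms_def list_all_iff)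
    then show ?thesis using False by simp
  qed (simp add: pure_powers_forms)
  moreover have "rank_ge (gens ?F r d (d + e)) (card (non_box_monomials d (d + e)) + weighted_rank
      d e m W fs)"
  proof (rule rank_ge_mono[OF rank_of_blocks[OF fs]])
    have "xmon ` non_box_monomials d (d + e) \<subseteq> gens ?F r d (d + e)"
      using r by (intro non_box_monomials_gens) auto
    moreover have "block_polys e m W fs w \<subseteq> gens ?F r d (d + e)" for w
    proof
      fix p :: "(4, 'k) mpoly" assume "p \<in> block_polys e m W fs w"
      then obtain a f where af: "p = xmon (exps a) * support_form f" "f \<in> set fs" "quad_degree a =
          e"
        by (auto simp: block_polys_def)
      then obtain k where k: "k < length fs" "f = fs ! k" by (metis in_set_conv_nth)
      have "xmon (exps a) * ?F (5 + k) \<in> gens ?F r d (d + e)"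
        using k r af(3) by (intro gensI) auto
      then show "p \<in> gens ?F r d (d + e)" using af k by simp
    qed
    ultimately show "xmon ` non_box_monomials d (d + e) \<union> (\<Union>w<m. block_polys e m W fs w) \<subseteq> mp.span
        (gens ?F r d (d + e))"
      using mp.span_superset by blast
  qed
  ultimately show ?thesis unfolding attained_def by (intro exI[of _ ?F] conjI ballI)
qed

section \<open>The expected Hilbert series\<close>

definition num_monomials :: "nat \<Rightarrow> nat" where
  "num_monomials j = (j + 3) choose 3"

abbreviation expected :: "nat \<Rightarrow> nat \<Rightarrow> nat \<Rightarrow> int" where
  "expected d \<equiv> iterated_difference d (\<lambda>j. int (num_monomials j))"

lemma card_monomials_4: "card {a :: 4 \<Rightarrow>\<^sub>0 nat. mon_degree a = j} = num_monomials j"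
proof -
  have "j + CARD(4) - 1 = j + 3" by simp
  then have "card {a :: 4 \<Rightarrow>\<^sub>0 nat. mon_degree a = j} = (j + 3) choose j"
    using card_monomials[of j, where 'v = 4] by (simp only:)
  also have "\<dots> = num_monomials j"
    unfolding num_monomials_def by (subst binomial_symmetric) simp_all
  finally show ?thesis .
qed

lemma card_box_monomials:
  assumes "d > 0"
  shows "int (card {a :: 4 \<Rightarrow>\<^sub>0 nat. mon_degree a = j \<and> (\<forall>v. Poly_Mapping.lookup a v < d)}) =
      expected d 4 j"
  using card_bounded_monomials[of "UNIV :: 4 set" d j] assms by (simp add: card_monomials_4)

lemma expected_4_nonneg: "d > 0 \<Longrightarrow> expected d 4 j \<ge> 0"
  by (simp flip: card_box_monomials)

lemma card_non_box_monomials: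
  assumes "d > 0"
  shows "int (card (non_box_monomials d j)) = int (num_monomials j) - expected d 4 j"
proof -
  let ?B = "{a :: 4 \<Rightarrow>\<^sub>0 nat. mon_degree a = j \<and> (\<forall>v. Poly_Mapping.lookup a v < d)}"
  have "{a. mon_degree a = j} = ?B \<union> non_box_monomials d j" "?B \<inter> non_box_monomials d j = {}"
    by (auto simp: non_box_monomials_def)
  moreover have "finite ?B" by (rule finite_subset[OF _ finite_monomials[of j]]) auto
  ultimately have "num_monomials j = card ?B + card (non_box_monomials d j)"
    using card_Un_disjoint[of ?B "non_box_monomials d j"] finite_non_box_monomials
    by (simp add: card_monomials_4[symmetric])
  then show ?thesis using card_box_monomials[OF assms, of j] by simp
qed

text \<open>The box has no monomials of degree above \<open>4 (d - 1)\<close>.\<close>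

lemma expected_4_eq_0:
  assumes "d > 0" "4 * d - 3 \<le> j"
  shows "expected d 4 j = 0"
proof -
  have "\<not> (mon_degree a = j \<and> (\<forall>v. Poly_Mapping.lookup a v < d))" for a :: "4 \<Rightarrow>\<^sub>0 nat"
  proof
    assume a: "mon_degree a = j \<and> (\<forall>v. Poly_Mapping.lookup a v < d)"
    have "Poly_Mapping.lookup a v \<le> d - 1" for v using a assms(1) by (metis One_nat_def Suc_pred
        less_Suc_eq_le)
    then have "mon_degree a \<le> (\<Sum>v\<in>(UNIV :: 4 set). d - 1)"
      unfolding mon_degree_superset[of UNIV a, simplified] by (intro sum_mono)
    then show False using a assms by simp
  qed
  then have "{a :: 4 \<Rightarrow>\<^sub>0 nat. mon_degree a = j \<and> (\<forall>v. Poly_Mapping.lookup a v < d)} = {}" by blast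
  then have "int (card {a :: 4 \<Rightarrow>\<^sub>0 nat. mon_degree a = j \<and> (\<forall>v. Poly_Mapping.lookup a v < d)}) = 0"
    by (simp only: card.empty of_nat_0)
  then show ?thesis using card_box_monomials[OF assms(1), of j] by simp
qed

lemma hf_0_expected: "hf F 0 d j = int (num_monomials j)" for F :: "nat \<Rightarrow> (4, 'k::field) mpoly"
  by (simp add: hf_0 card_monomials_4)

lemma hf_le_if_rank_ge:
  fixes F :: "nat \<Rightarrow> (4, 'k::field) mpoly"
  assumes "rank_ge (gens F r d j) n"
  shows "hf F r d j \<le> int (num_monomials j) - int n"
  using assms by (simp add: rank_ge_iff_dim hf_def card_monomials_4)

lemma fps_nth_expected:
  "fps_nth ((1 - fps_X ^ d) ^ r / (1 - fps_X) ^ 4) j = (of_int (expected d r j) :: rat)"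
proof -
  define A :: "rat fps" where "A = Abs_fps (\<lambda>j. of_nat (num_monomials j))"
  have "inverse ((1 - fps_X) ^ 4) = A"
  proof -
    have coeff: "(4 + k - 1) choose k = num_monomials k" for k
    proof -
      have "4 + k - 1 = k + 3" by simp
      then show ?thesis
        unfolding num_monomials_def by (simp only:) (subst binomial_symmetric, simp_all)
    qed
    have "inverse ((1 - fps_const 1 * fps_X) ^ 4) = Abs_fps (\<lambda>k. of_nat ((4 + k - 1) choose k) *
        (1 :: rat) ^ k)"
      by (rule one_minus_const_fps_X_neg_power') simp
    then show ?thesis unfolding coeff A_def by simp
  qed
  then have "(1 - fps_X ^ d) ^ r / (1 - fps_X) ^ 4 = (1 - fps_X ^ d) ^ r * A"
    by (subst fps_divide_unit) simp_all
  moreover have "fps_nth ((1 - fps_X ^ d) ^ r * A) j = of_int (expected d r j)"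
  proof (induction r arbitrary: j)
    case 0
    show ?case by (simp add: A_def)
  next
    case (Suc r)
    have "(1 - fps_X ^ d) ^ Suc r * A = (1 - fps_X ^ d) ^ r * A - fps_X ^ d * ((1 - fps_X ^ d) ^ r
        * A)"
      by (simp add: algebra_simps)
    then show ?case by (simp add: fps_X_power_mult_nth Suc.IH)
  qed
  ultimately show ?thesis by simp
qed

text \<open>The maximum takes care of the degree of the first nonpositive coefficient, where the Hilbert function
  vanishes. All higher degrees are then determined.\<close>

definition froeberg :: "nat \<Rightarrow> nat \<Rightarrow> (nat \<Rightarrow> (4, 'k::field) mpoly) \<Rightarrow> bool" where
  "froeberg d r F \<longleftrightarrow> (\<forall>j. (\<forall>i<j. expected d r i > 0) \<longrightarrow> hf F r d j = max 0 (expected d r j))"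

text \<open>Once the Hilbert function vanishes it stays zero, just as the truncation does.\<close>

lemma hilbert_series_if_froeberg:
  fixes F :: "nat \<Rightarrow> (4, 'k::field) mpoly"
  assumes F: "F \<in> form_tuples d r" and "d > 0" and fr: "froeberg d r F"
  shows "hilbert_series (ideal_of (F ` {1..r})) =
    positive_truncation ((1 - fps_X ^ d) ^ r / (1 - fps_X) ^ 4)"
proof (rule fps_ext)
  fix j
  have Ff: "F i \<in> forms d" if "i \<in> {1..r}" for i using F that by (auto simp: form_tuples_def)
  have "int (hilbert_function (ideal_of (F ` {1..r})) j) = hf F r d j"
    by (rule hilbert_function_hf[OF Ff \<open>d > 0\<close>])
  then have "of_nat (hilbert_function (ideal_of (F ` {1..r})) j) = (of_int (hf F r d j) :: rat)"
    by (metis of_int_of_nat_eq)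
  moreover have "hf F r d j = (if \<forall>i\<le>j. expected d r i > 0 then expected d r j else 0)"
  proof (cases "\<forall>i\<le>j. expected d r i > 0")
    case True
    then have "hf F r d j = max 0 (expected d r j)" using fr by (simp add: froeberg_def)
    moreover have "expected d r j > 0" using True by blast
    ultimately show ?thesis using True by simp
  next
    case False
    define i0 where "i0 = (LEAST i. expected d r i \<le> 0)"
    obtain i where i: "i \<le> j" "expected d r i \<le> 0" using False by (auto simp: not_less)
    have i0: "expected d r i0 \<le> 0" unfolding i0_def using i(2) by (rule LeastI)
    have "i0 \<le> j" unfolding i0_def using i Least_le[of "\<lambda>i. expected d r i \<le> 0" i] by simp
    have "expected d r i > 0" if "i < i0" for i
      using not_less_Least[OF that[unfolded i0_def]] by (simp add: not_le)
    then have "hf F r d i0 = 0" using fr i0 by (simp add: froeberg_def)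
    with \<open>i0 \<le> j\<close> have "hf F r d j = 0"
    proof (induction j rule: dec_induct)
      case (step n)
      show ?case by (rule hf_eq_0_Suc[OF Ff step.IH[OF step.prems]])
    qed
    then show ?thesis using False by auto
  qed
  ultimately show "fps_nth (hilbert_series (ideal_of (F ` {1..r}))) j =
      fps_nth (positive_truncation ((1 - fps_X ^ d) ^ r / (1 - fps_X) ^ 4)) j"
    unfolding hilbert_series_def positive_truncation_def fps_nth_Abs_fps fps_nth_expected
        of_int_0_less_iff
    by (simp only: if_distrib[of of_int] of_int_0)
qed

lemma expected_less: "e < d \<Longrightarrow> expected d r e = int (num_monomials e)"
  by (induction r) auto

lemma expected_linear: "e < d \<Longrightarrow> expected d r (d + e) = int (num_monomials (d + e)) - int r * int
    (num_monomials e)"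
  by (induction r) (auto simp: expected_less algebra_simps)

section \<open>Transfer of ranks to other degrees and numbers of forms\<close>

lemma attainedI:
  fixes F :: "nat \<Rightarrow> (4, 'k::field) mpoly"
  assumes "\<And>i. i \<in> {1..r} \<Longrightarrow> F i \<in> forms d" "rank_ge (gens F r d j) n"
  shows "attained TYPE('k) d r j n"
  using assms unfolding attained_def by blast

text \<open>Further forms are taken to be zero, which leaves the ideal unchanged.\<close>

lemma attained_more_forms:
  assumes "attained TYPE('k::field) d r j n" "r \<le> r'"
  shows "attained TYPE('k) d r' j n"
proof -
  obtain F :: "nat \<Rightarrow> (4, 'k) mpoly" where F: "\<forall>i\<in>{1..r}. F i \<in> forms d" "rank_ge (gens F r d j) n"
    using assms(1) unfolding attained_def by blast
  let ?F = "\<lambda>i. if i \<le> r then F i else 0"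
  have "?F i \<in> forms d" if "i \<in> {1..r'}" for i
    using F(1) that mp.subspace_0[OF subspace_forms] by auto
  moreover have "rank_ge (gens ?F r' d j) n"
  proof (rule rank_ge_mono[OF F(2)])
    show "gens F r d j \<subseteq> mp.span (gens ?F r' d j)"
    proof
      fix p assume "p \<in> gens F r d j"
      then obtain a i where ai: "p = xmon a * F i" "i \<in> {1..r}" "mon_degree a + d = j" by (rule
          gensE)
      have "xmon a * ?F i \<in> gens ?F r' d j"
        by (rule gensI) (use ai assms(2) in auto)
      moreover have "xmon a * ?F i = p" using ai by simp
      ultimately show "p \<in> mp.span (gens ?F r' d j)" using mp.span_base[of p] by simp
    qed
  qed
  ultimately show ?thesis by (rule attainedI)
qed

lemma attained_injective_descends:
  assumes "attained TYPE('k::field) d r' (d + e') (r' * num_monomials e')" "r \<le> r'" "e \<le> e'"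
  shows "attained TYPE('k) d r (d + e) (r * num_monomials e)"
proof -
  obtain F :: "nat \<Rightarrow> (4, 'k) mpoly" where F: "\<forall>i\<in>{1..r'}. F i \<in> forms d"
      "rank_ge (gens F r' d (d + e')) (r' * num_monomials e')"
    using assms(1) unfolding attained_def by blast
  have "rank_ge (gens F r' d (d + e)) (r' * num_monomials e)"
    using full_rank_le_degree[of F r' d e' e] F(2) assms(3) by (simp add: card_monomials_4)
  then have "rank_ge (gens F r d (d + e)) (r * num_monomials e)"
    using full_rank_fewer_forms[of F r' d e r] assms(2) by (simp add: card_monomials_4)
  then show ?thesis using F(1) assms(2) unfolding attained_def by (intro exI[of _ F]) auto
qed

text \<open>All monomials of degree \<open>d\<close> are taken as generators.\<close>

lemma attained_spanning:
  assumes "num_monomials d \<le> r"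
  shows "attained TYPE('k::field) d r d (num_monomials d)"
proof -
  obtain as :: "(4 \<Rightarrow>\<^sub>0 nat) list" where as: "set as = {a. mon_degree a = d}" "distinct as"
    using finite_distinct_list[OF finite_monomials[of d]] by blast
  have len: "length as = num_monomials d"
    using distinct_card[OF as(2)] as(1) card_monomials_4[of d] by simp
  let ?F = "\<lambda>i. xmon (as ! (i - 1)) :: (4, 'k) mpoly"
  have "?F i \<in> forms d" if "i \<in> {1..num_monomials d}" for i
  proof -
    have "as ! (i - 1) \<in> set as" using that len by (intro nth_mem) auto
    then show ?thesis using as(1) by (simp add: forms_def)
  qed
  moreover have "rank_ge (gens ?F (num_monomials d) d d) (num_monomials d)"
  proof -
    have "xmon ` {a. mon_degree a = d} \<subseteq> mp.span (gens ?F (num_monomials d) d d)"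
    proof (rule image_subsetI)
      fix a :: "4 \<Rightarrow>\<^sub>0 nat" assume "a \<in> {a. mon_degree a = d}"
      then have "a \<in> set as" using as(1) by simp
      then obtain k where k: "k < length as" "a = as ! k" by (metis in_set_conv_nth)
      have "xmon 0 * ?F (Suc k) \<in> gens ?F (num_monomials d) d d"
        using k len by (intro gensI) auto
      then show "xmon a \<in> mp.span (gens ?F (num_monomials d) d d)"
        using k by (intro mp.span_base) simp
    qed
    then have "rank_ge (gens ?F (num_monomials d) d d) (card {a :: 4 \<Rightarrow>\<^sub>0 nat. mon_degree a = d})"
      by (rule rank_ge_mono[OF rank_ge_monoms[OF finite_monomials]])
    then show ?thesis by (simp only: card_monomials_4)
  qed
  ultimately have "attained TYPE('k) d (num_monomials d) d (num_monomials d)"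
    by (rule attainedI)
  then show ?thesis using assms by (rule attained_more_forms)
qed

lemma generic_if_attained:
  assumes "attained TYPE('k::field_char_0) d r j n"
  shows "generic d r (\<lambda>F :: nat \<Rightarrow> (4, 'k) mpoly. hf F r d j \<le> int (num_monomials j) - int n)"
proof -
  obtain G :: "nat \<Rightarrow> (4, 'k) mpoly" where G: "\<forall>i\<in>{1..r}. G i \<in> forms d" "rank_ge (gens G r d j) n"
    using assms unfolding attained_def by blast
  have ext: "gens (extend_tuple r (\<lambda>_. 0) F) r d j = gens F r d j" for F :: "nat \<Rightarrow> (4, 'k) mpoly"
    by (rule gens_cong) (simp add: extend_tuple_def)
  have "generic d r (\<lambda>F :: nat \<Rightarrow> (4, 'k) mpoly. rank_ge (gens (extend_tuple r (\<lambda>_. 0) F) r d j) n)"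
    by (rule generic_rank_ge[where G = G]) (use G ext in auto)
  then show ?thesis by (rule generic_mono) (simp add: ext hf_le_if_rank_ge)
qed

lemma generic_upper_bounds:
  assumes "finite J" "\<And>j. j \<in> J \<Longrightarrow> attained TYPE('k::field_char_0) d r j (n j)"
  shows "generic d r (\<lambda>F :: nat \<Rightarrow> (4, 'k) mpoly. \<forall>j\<in>J. hf F r d j \<le> int (num_monomials j) - int (n
      j))"
  using assms by (intro generic_ball generic_if_attained)

section \<open>Generic Hilbert functions from attained ranks\<close>

text \<open>As the expected coefficient in degree \<open>d + e\<close> is nonpositive, only degrees up to that one matter. The
  products \<open>x\<^sup>a F\<^sub>i\<close> are independent one degree below it, hence in all lower degrees, and span in degree
  \<open>d + e\<close>. If \<open>e = 0\<close>, there are no products of lower degree.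
  For \<open>e = d\<close> the coefficient in degree \<open>2 d\<close> involves Koszul relations, but as it is
  nonpositive, only \<open>hf = 0\<close> has to be shown there.\<close>

lemma froeberg_generic_between:
  assumes "d > 0" "e \<le> d" "r2 \<le> r"
    and inj: "e = 0 \<or> (r \<le> r1 \<and> attained TYPE('k::field_char_0) d r1 (d + (e - 1)) (r1 *
        num_monomials (e - 1)))"
    and surj: "attained TYPE('k) d r2 (d + e) (num_monomials (d + e))"
    and neg: "expected d r (d + e) \<le> 0"
  shows "generic d r (froeberg d r :: (nat \<Rightarrow> (4, 'k) mpoly) \<Rightarrow> bool)"
proof -
  define n where "n j = (if j = d + e then num_monomials j else r * num_monomials (j - d))" for j
  have att: "attained TYPE('k) d r j (n j)" if "j \<in> {d..d + e}" for j
  proof (cases "j = d + e")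
    case True
    then show ?thesis using attained_more_forms[OF surj \<open>r2 \<le> r\<close>] by (simp add: n_def)
  next
    case False
    then have "e \<noteq> 0" and le: "j - d \<le> e - 1" using that by auto
    then have r1: "r \<le> r1" "attained TYPE('k) d r1 (d + (e - 1)) (r1 * num_monomials (e - 1))"
      using inj by blast+
    have "attained TYPE('k) d r (d + (j - d)) (r * num_monomials (j - d))"
      by (rule attained_injective_descends[OF r1(2,1) le])
    moreover have "d + (j - d) = j" using that by simp
    ultimately show ?thesis using False by (simp only: n_def if_False)
  qed
  have "generic d r (\<lambda>F :: nat \<Rightarrow> (4, 'k) mpoly. \<forall>j\<in>{d..d + e}. hf F r d j \<le> int (num_monomials j)
      - int (n j))"
    using att by (rule generic_upper_bounds[OF finite_atLeastAtMost])
  then show ?thesis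
  proof (rule generic_mono)
    fix F :: "nat \<Rightarrow> (4, 'k) mpoly"
    assume F: "F \<in> form_tuples d r"
      and ub: "\<forall>j\<in>{d..d + e}. hf F r d j \<le> int (num_monomials j) - int (n j)"
    have nonneg: "hf F r d j \<ge> 0" for j
      by (rule hf_nonneg) (use F in \<open>auto simp: form_tuples_def\<close>)
    show "froeberg d r F"
      unfolding froeberg_def
    proof (intro allI impI)
      fix j assume pos: "\<forall>i<j. expected d r i > 0"
      have j: "j \<le> d + e" using pos neg by (meson not_less)
      consider "j < d" | "d \<le> j" "j < d + e" | "j = d + e" using j by linarith
      then show "hf F r d j = max 0 (expected d r j)"
      proof cases
        case 1
        then show ?thesis by (simp add: expected_less hf_less hf_0_expected)
      next
        case 2
        then obtain k where k: "j = d + k" "k < e" using less_imp_add_positive by (metis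
            add_less_cancel_left le_Suc_ex)
        have "hf F r d j \<ge> expected d r j"
          using hf_ge[of F d k r] k \<open>e \<le> d\<close> by (simp add: expected_linear hf_0_expected)
        moreover have "hf F r d j \<le> expected d r j"
          using ub 2 k \<open>e \<le> d\<close> by (auto simp: n_def expected_linear dest!: bspec[of _ _ j])
        ultimately show ?thesis using nonneg[of j] by simp
      next
        case 3
        then show ?thesis using ub neg nonneg[of j] by (auto simp: n_def dest!: bspec[of _ _ j])
      qed
    qed
  qed
qed

text \<open>The tuple is completed by powers \<open>x\<^sub>i\<^sup>d\<close> to at least four forms. Generically the ideal of the first
  four is as large as that of \<open>x\<^sub>1\<^sup>d, \<dots>, x\<^sub>4\<^sup>d\<close> in the finitely many degrees up to \<open>4 d - 3\<close>, where the
  quotient vanishes, and therefore in all degrees. Then \<open>chain_of_inequalities_exact\<close> gives the Hilbert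
  functions of all initial segments.\<close>

lemma generic_complete_intersection:
  assumes d: "d > 0" and r: "r \<le> 5"
  shows "generic d r (\<lambda>F :: nat \<Rightarrow> (4, 'k::field_char_0) mpoly. \<forall>i\<le>min r 4. \<forall>j. hf F i d j =
      expected d i j)"
proof -
  let ?c = "pure_powers d :: nat \<Rightarrow> (4, 'k) mpoly"
  let ?ext = "extend_tuple r ?c"
  let ?N = "4 * d - 3"
  have "generic d r (\<lambda>F. rank_ge (gens (?ext F) 4 d j) (card (non_box_monomials d j)))" for j
  proof (rule generic_rank_ge[where G = ?c])
    have "xmon ` non_box_monomials d j \<subseteq> gens (?ext ?c) 4 d j"
      by (rule non_box_monomials_gens) (auto simp: extend_tuple_def)
    then show "rank_ge (gens (?ext ?c) 4 d j) (card (non_box_monomials d j))"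
      using mp.span_superset by (intro rank_ge_mono[OF rank_ge_monoms[OF
          finite_non_box_monomials]]) blast
  qed (auto simp: pure_powers_forms)
  then have "generic d r (\<lambda>F. \<forall>j\<in>{..?N}. rank_ge (gens (?ext F) 4 d j) (card (non_box_monomials d
      j)))"
    by (intro generic_ball) auto
  then show ?thesis
  proof (rule generic_mono)
    fix F :: "nat \<Rightarrow> (4, 'k) mpoly"
    assume F: "F \<in> form_tuples d r"
      and rk: "\<forall>j\<in>{..?N}. rank_ge (gens (?ext F) 4 d j) (card (non_box_monomials d j))"
    have Ff: "?ext F i \<in> forms d" if "i \<in> {1..4}" for i
      using F that by (auto simp: extend_tuple_def form_tuples_def pure_powers_forms)
    have le: "hf (?ext F) 4 d j \<le> expected d 4 j" if "j \<le> ?N" for j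
    proof -
      have "hf (?ext F) 4 d j \<le> int (num_monomials j) - int (card (non_box_monomials d j))"
        by (rule hf_le_if_rank_ge) (use rk that in auto)
      then show ?thesis by (simp add: card_non_box_monomials[OF d])
    qed
    have "hf (?ext F) 4 d j = 0" if "?N \<le> j" for j
      using that
    proof (induction j rule: dec_induct)
      case base
      have "hf (?ext F) 4 d ?N \<le> 0" using le[of ?N] expected_4_eq_0[OF d, of ?N] by simp
      moreover have "hf (?ext F) 4 d ?N \<ge> 0" by (rule hf_nonneg[OF Ff])
      ultimately show ?case by simp
    next
      case (step j)
      show ?case by (rule hf_eq_0_Suc[OF Ff step.IH])
    qed
    then have le': "hf (?ext F) 4 d j \<le> expected d 4 j" for j
      using le[of j] expected_4_nonneg[OF d, of j] by (cases "j \<le> ?N") auto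
    have eq: "hf (?ext F) i d j = expected d i j" if "i \<le> 4" for i j
    proof (rule chain_of_inequalities_exact[where n = 4 and H = "\<lambda>i. hf (?ext F) i d"])
      fix i j :: nat assume i: "i < 4"
      show "hf (?ext F) i d j \<le> hf (?ext F) (Suc i) d j + (if d \<le> j then hf (?ext F) i d (j - d)
          else 0)"
      proof (cases "d \<le> j")
        case True
        have "hf (?ext F) i d (d + (j - d)) \<le> hf (?ext F) (Suc i) d (d + (j - d)) + hf (?ext F) i
            d (j - d)"
          by (rule hf_exact) (use Ff i in auto)
        then show ?thesis using True by simp
      next
        case False
        then show ?thesis
          using hf_less[of j d "?ext F" i] hf_less[of j d "?ext F" "Suc i"] by simp
      qed
    qed (rule d hf_0_expected le' that)+
    have "hf F i d j = hf (?ext F) i d j" if "i \<le> r" for i j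
      unfolding hf_def using gens_cong[of i F "?ext F" d j] that by (simp add: extend_tuple_def)
    then show "\<forall>i\<le>min r 4. \<forall>j. hf F i d j = expected d i j" using eq by simp
  qed
qed

lemma froeberg_generic_at_most_4:
  assumes "d > 0" "r \<le> 4"
  shows "generic d r (froeberg d r :: (nat \<Rightarrow> (4, 'k::field_char_0) mpoly) \<Rightarrow> bool)"
proof (rule generic_mono[OF generic_complete_intersection[OF assms(1), of r]])
  fix F :: "nat \<Rightarrow> (4, 'k) mpoly"
  assume F: "F \<in> form_tuples d r" and eq: "\<forall>i\<le>min r 4. \<forall>j. hf F i d j = expected d i j"
  have "hf F r d j \<ge> 0" for j by (rule hf_nonneg) (use F in \<open>auto simp: form_tuples_def\<close>)
  then show "froeberg d r F" using eq assms(2) by (simp add: froeberg_def)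
qed (use assms in simp)

text \<open>The first four forms are generically a complete intersection, so \<open>hf_exact\<close> shows that the Hilbert
  function is at least the expected one; the attained ranks supply the converse.\<close>

lemma froeberg_generic_5:
  assumes d: "d > 0"
    and att: "\<And>j. j \<in> {d..N} \<Longrightarrow> attained TYPE('k::field_char_0) d 5 j (nat (int (num_monomials j) -
        max 0 (expected d 5 j)))"
    and neg: "expected d 5 N \<le> 0"
  shows "generic d 5 (froeberg d 5 :: (nat \<Rightarrow> (4, 'k) mpoly) \<Rightarrow> bool)"
proof -
  let ?n = "\<lambda>j. nat (int (num_monomials j) - max 0 (expected d 5 j))"
  have "generic d 5 (\<lambda>F :: nat \<Rightarrow> (4, 'k) mpoly. \<forall>i\<le>min 5 4. \<forall>j. hf F i d j = expected d i j)"
    by (rule generic_complete_intersection[OF d]) simp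
  moreover have "generic d 5 (\<lambda>F :: nat \<Rightarrow> (4, 'k) mpoly. \<forall>j\<in>{d..N}. hf F 5 d j \<le> int
      (num_monomials j) - int (?n j))"
    using att by (rule generic_upper_bounds[OF finite_atLeastAtMost])
  ultimately have "generic d 5 (\<lambda>F :: nat \<Rightarrow> (4, 'k) mpoly. (\<forall>i\<le>min 5 4. \<forall>j. hf F i d j = expected
      d i j)
      \<and> (\<forall>j\<in>{d..N}. hf F 5 d j \<le> int (num_monomials j) - int (?n j)))"
    by (rule generic_conj)
  then show ?thesis
  proof (rule generic_mono)
    fix F :: "nat \<Rightarrow> (4, 'k) mpoly"
    assume F: "F \<in> form_tuples d 5"
      and H: "(\<forall>i\<le>min 5 4. \<forall>j. hf F i d j = expected d i j)
        \<and> (\<forall>j\<in>{d..N}. hf F 5 d j \<le> int (num_monomials j) - int (?n j))"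
    have eq: "hf F 4 d j = expected d 4 j" for j using H by simp
    have Ff: "F i \<in> forms d" if "i \<in> {1..5}" for i using F that by (auto simp: form_tuples_def)
    show "froeberg d 5 F"
      unfolding froeberg_def
    proof (intro allI impI)
      fix j assume pos: "\<forall>i<j. expected d 5 i > 0"
      have j: "j \<le> N" using pos neg by (meson not_less)
      show "hf F 5 d j = max 0 (expected d 5 j)"
      proof (cases "j < d")
        case True
        then show ?thesis by (simp add: expected_less hf_less hf_0_expected)
      next
        case False
        have "hf F 5 d j \<le> int (num_monomials j) - int (?n j)" using H False j by simp
        also have "\<dots> \<le> max 0 (expected d 5 j)" by simp
        finally have "hf F 5 d j \<le> max 0 (expected d 5 j)" .
        moreover have "hf F 5 d j \<ge> 0" by (rule hf_nonneg[OF Ff])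
        moreover have "hf F 5 d j \<ge> expected d 5 j"
        proof -
          have "hf F 4 d (d + (j - d)) \<le> hf F (Suc 4) d (d + (j - d)) + hf F 4 d (j - d)"
            by (rule hf_exact) (use Ff in auto)
          moreover have "expected d (Suc 4) j = expected d 4 j - expected d 4 (j - d)"
            using False by (simp only: iterated_difference.simps not_less if_True)
          moreover have "Suc 4 = 5" "d + (j - d) = j" using False by simp_all
          ultimately show ?thesis by (simp only: eq)
        qed
        ultimately show ?thesis by simp
      qed
    qed
  qed
qed

lemma attained_from_blocks:
  assumes "weighted_forms d m W fs" "d > 0" "r = 4 + length fs" "j = d + e"
    and "int n \<le> int (num_monomials j) - expected d 4 j + int (weighted_rank d e m W fs)"
  shows "attained TYPE('k::field_char_0) d r j n"
proof -
  have "n \<le> card (non_box_monomials d j) + weighted_rank d e m W fs"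
    using assms(5) card_non_box_monomials[OF assms(2), of j] by linarith
  then show ?thesis
    using attained_witness[OF assms(1,3), of e, where 'k = 'k] rank_ge_less[of "gens _ r d j"]
    unfolding attained_def assms(4) by meson
qed

text \<open>Below degree \<open>2 d\<close> the expected coefficients are linear in \<open>r\<close>.\<close>

lemma froeberg_generic_linear:
  assumes "e < d" "r2 \<le> r"
    and inj: "e = 0 \<or> (r \<le> r1 \<and> attained TYPE('k::field_char_0) d r1 (d + (e - 1)) (r1 *
        num_monomials (e - 1)))"
    and surj: "attained TYPE('k) d r2 (d + e) (num_monomials (d + e))"
    and neg: "num_monomials (d + e) \<le> r * num_monomials e"
  shows "generic d r (froeberg d r :: (nat \<Rightarrow> (4, 'k) mpoly) \<Rightarrow> bool)"
proof (rule froeberg_generic_between[OF _ _ assms(2) inj surj])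
  show "expected d r (d + e) \<le> 0"
    using neg unfolding expected_linear[OF assms(1)] by (simp flip: of_nat_mult)
qed (use assms in auto)

text \<open>In degrees below \<open>2 d\<close> the ranks follow from independence for some \<open>r \<ge> 5\<close> in degree
  \<open>2 d - 1\<close>.\<close>

lemma froeberg_generic_5_from_rank:
  assumes d: "d > 0"
    and inj: "attained TYPE('k::field_char_0) d r (d + (d - 1)) (r * num_monomials (d - 1))" "5 \<le> r"
    and att: "\<And>j. j \<in> {2 * d..N} \<Longrightarrow> attained TYPE('k) d 5 j (nat (int (num_monomials j) - max 0
        (expected d 5 j)))"
    and neg: "expected d 5 N \<le> 0"
  shows "generic d 5 (froeberg d 5 :: (nat \<Rightarrow> (4, 'k) mpoly) \<Rightarrow> bool)"
proof (rule froeberg_generic_5[OF d _ neg])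
  fix j assume j: "j \<in> {d..N}"
  show "attained TYPE('k) d 5 j (nat (int (num_monomials j) - max 0 (expected d 5 j)))"
  proof (cases "j < 2 * d")
    case False
    then show ?thesis using j by (intro att) simp
  next
    case True
    define e where "e = j - d"
    have e: "j = d + e" "e < d" using True j by (auto simp: e_def)
    have "attained TYPE('k) d 5 (d + e) (5 * num_monomials e)"
      by (rule attained_injective_descends[OF inj]) (use e in simp)
    moreover have "nat (int (num_monomials j) - max 0 (expected d 5 j)) \<le> 5 * num_monomials e"
      using expected_linear[OF e(2), of 5] e(1) by simp
    ultimately show ?thesis
      unfolding attained_def e(1) using rank_ge_less by blast
  qed
qed

section \<open>Explicit forms of degree five\<close>

text \<open>The name \<open>attained_d_r_j\<close> refers to \<open>r\<close> forms of degree \<open>d\<close> and their multiples of degree \<open>j\<close>. For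
  \<open>r > 5\<close> the rank is either \<open>r dim S\<^bsub>j-d\<^esub>\<close> or \<open>dim S\<^sub>j\<close>. For \<open>r = 5\<close> it is \<open>dim S\<^sub>j\<close> or falls short of
  \<open>5 dim S\<^bsub>j-d\<^esub>\<close> by the \<open>10 dim S\<^bsub>j-2d\<^esub>\<close> Koszul relations. The lists \<open>fs\<close> contain the monomials of the
  forms other than the four powers, and \<open>W\<close> consists of the weights modulo \<open>m\<close> of the variables. The
  weights were chosen so that the blocks are small and their shapes permit the maximal rank, the
  monomials by random search.\<close>

lemma attained_5_21_6: "attained TYPE('k::field_char_0) 5 21 6 84"
  by (rule attained_from_blocks[where e = 1 and m = 13 and W = "(0,6,10,4)" and fs = "
    [[(0,4,0,1), (1,0,2,2)], [(1,0,3,1), (3,0,0,2), (0,1,2,2)], [(1,2,2,0)], [(2,2,0,1)],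
    [(0,2,1,2), (2,0,3,0), (4,0,0,1)], [(0,0,2,3), (4,1,0,0)], [(1,2,0,2), (2,1,1,1)], [(0,4,1,0),
    (3,0,0,2)], [(3,2,0,0), (0,3,2,0), (2,0,0,3)], [(1,3,0,1), (2,2,1,0), (1,0,1,3)], [(1,0,4,0),
    (3,0,1,1)], [(2,1,2,0), (0,0,1,4)], [(1,0,0,4), (0,2,3,0)], [(4,0,1,0), (3,1,0,1)],
    [(0,2,0,3), (1,4,0,0)], [(2,0,1,2)], [(0,0,4,1), (1,1,0,3), (2,0,1,2)]]"];
      code_simp)

lemma attained_5_12_7: "attained TYPE('k::field_char_0) 5 12 7 120"
  by (rule attained_from_blocks[where e = 2 and m = 16 and W = "(0,11,15,10)" and fs = "
    [[(1,4,0,0), (1,0,4,0), (0,0,2,3)], [(3,2,0,0), (0,0,4,1)], [(0,3,0,2), (2,2,1,0)],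
    [(2,0,3,0), (0,1,2,2), (1,0,1,3)], [(3,0,2,0), (2,0,0,3)], [(0,3,2,0), (1,2,1,1)], [(2,1,1,1),
    (1,2,2,0), (3,0,0,2)], [(1,1,2,1), (2,0,1,2), (0,1,0,4)]]"];
      code_simp)

lemma attained_5_8_8: "attained TYPE('k::field_char_0) 5 8 8 160"
  by (rule attained_from_blocks[where e = 3 and m = 10 and W = "(0,3,7,1)" and fs = "
    [[(4,1,0,0), (2,0,0,3), (0,0,3,2)], [(1,1,3,0), (3,0,2,0), (1,2,1,1)], [(0,4,1,0), (0,2,0,3),
    (0,0,4,1)], [(0,0,2,3), (0,1,0,4), (2,2,0,1)]]"];
      code_simp)

lemma attained_5_9_8: "attained TYPE('k::field_char_0) 5 9 8 165"
  by (rule attained_from_blocks[where e = 3 and m = 12 and W = "(0,8,10,11)" and fs = "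
    [[(3,0,2,0), (0,3,2,0), (1,4,0,0)], [(0,0,3,2), (0,1,0,4), (3,2,0,0)], [(1,1,3,0), (1,2,0,2)],
    [(0,3,2,0), (1,0,0,4), (4,1,0,0)], [(0,3,1,1), (2,0,0,3)]]"];
      code_simp)

lemma attained_5_6_9: "attained TYPE('k::field_char_0) 5 6 9 210"
  by (rule attained_from_blocks[where e = 4 and m = 7 and W = "(0,5,1,4)" and fs = "
    [[(1,0,1,3), (0,2,3,0), (2,1,0,2), (1,4,0,0)], [(0,3,1,1), (2,0,2,1), (1,4,0,0)]]"];
      code_simp)

lemma attained_5_7_9: "attained TYPE('k::field_char_0) 5 7 9 220"
  by (rule attained_from_blocks[where e = 4 and m = 16 and W = "(0,4,2,3)" and fs = "
    [[(1,4,0,0), (0,1,0,4), (0,2,1,2)], [(3,2,0,0), (1,0,4,0), (2,0,1,2)], [(1,1,2,1),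
        (0,0,4,1)]]"];
      code_simp)

lemma attained_5_6_10: "attained TYPE('k::field_char_0) 5 6 10 286"
  by (rule attained_from_blocks[where e = 5 and m = 15 and W = "(0,6,14,9)" and fs = "
    [[(0,1,0,4), (1,3,0,1), (2,0,3,0)], [(0,2,1,2), (4,0,1,0)]]"];
      code_simp)

lemma attained_5_5_10: "attained TYPE('k::field_char_0) 5 5 10 270"
  by (rule attained_from_blocks[where e = 5 and m = 14 and W = "(0,6,7,1)" and fs = "
    [[(0,2,1,2), (2,0,3,0), (3,1,0,1)]]"];
      code_simp)

lemma attained_5_5_11: "attained TYPE('k::field_char_0) 5 5 11 364"
  by (rule attained_from_blocks[where e = 6 and m = 12 and W = "(0,4,5,3)" and fs = "
    [[(2,0,0,3), (0,2,2,1), (3,1,1,0)]]"];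
      code_simp)

section \<open>Explicit forms of degree seven\<close>

lemma attained_7_41_8: "attained TYPE('k::field_char_0) 7 41 8 164"
  by (rule attained_from_blocks[where e = 1 and m = 15 and W = "(0,13,7,6)" and fs = "
    [[(0,1,4,2), (1,2,3,1), (2,3,2,0)], [(3,0,3,1), (1,3,0,3)], [(1,0,0,6), (6,0,0,1), (1,2,1,3)],
    [(2,0,1,4), (1,1,3,2), (3,3,1,0)], [(4,2,0,1), (2,0,2,3)], [(0,5,0,2), (2,0,2,3), (0,0,5,2)],
    [(1,1,4,1), (4,2,0,1), (2,2,3,0)], [(2,4,1,0)], [(3,0,0,4), (3,2,1,1)], [(2,0,1,4), (0,2,5,0),
    (3,3,1,0)], [(4,0,2,1)], [(0,3,0,4), (3,1,2,1), (1,1,5,0), (0,5,1,1), (2,0,3,2)], [(1,1,3,2),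
    (0,0,4,3), (3,1,0,3)], [(4,2,0,1), (2,0,2,3), (3,1,1,2), (2,2,3,0)], [(1,5,0,1), (2,1,4,0),
    (0,4,1,2)], [(3,1,3,0)], [(2,0,4,1), (0,1,0,6)], [(2,0,3,2), (0,3,0,4), (4,0,0,3)],
    [(2,2,1,2), (0,2,4,1)], [(1,3,2,1)], [(1,0,4,2), (0,1,6,0), (4,1,0,2)], [(5,0,0,2), (4,1,2,0),
    (1,0,6,0)], [(5,2,0,0), (2,1,4,0), (1,5,0,1), (4,1,1,1)], [(3,3,0,1), (1,3,3,0), (1,1,2,3)],
    [(4,0,0,3), (1,6,0,0), (0,0,6,1)], [(1,2,0,4), (2,0,5,0)], [(0,3,4,0), (3,4,0,0)], [(3,3,0,1),
    (2,0,0,5), (0,0,3,4)], [(0,5,2,0), (0,1,0,6)], [(2,1,0,4), (6,0,1,0), (1,0,1,5)], [(5,0,1,1),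
    (0,4,3,0), (3,0,4,0)], [(1,6,0,0), (2,0,3,2)], [(4,0,3,0), (0,3,3,1)], [(1,1,1,4), (0,2,3,2),
    (5,0,2,0)], [(2,4,0,1), (0,0,1,6), (0,2,2,3), (1,3,1,2)], [(5,1,1,0), (2,5,0,0), (0,1,1,5),
    (2,0,5,0)], [(6,1,0,0), (0,2,2,3), (1,1,0,5), (1,3,1,2)]]"];
      code_simp)

lemma attained_7_42_8: "attained TYPE('k::field_char_0) 7 42 8 165"
  by (rule attained_from_blocks[where e = 1 and m = 20 and W = "(0,17,16,4)" and fs = "
    [[(4,0,2,1), (2,0,3,2)], [(0,2,5,0), (5,2,0,0), (0,2,0,5)], [(1,2,0,4)], [(2,0,2,3)],
    [(0,1,4,2), (1,5,0,1)], [(5,0,1,1)], [(2,4,1,0), (3,0,4,0), (1,0,0,6), (0,0,3,4), (0,4,2,1),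
    (6,0,0,1)], [(1,2,4,0)], [(2,2,0,3), (3,2,2,0), (0,2,1,4)], [(0,0,5,2)], [(2,0,0,5),
    (5,0,1,1), (2,0,5,0), (1,4,2,0)], [(0,1,5,1), (3,1,1,2), (5,1,0,1), (2,1,4,0)], [(1,3,1,2)],
    [(0,2,0,5), (3,2,1,1), (1,2,2,2)], [(2,0,4,1)], [(4,2,0,1)], [(0,4,0,3)], [(3,4,0,0),
    (1,0,2,4)], [(0,5,2,0)], [(1,5,0,1), (4,1,2,0), (1,1,1,4)], [(2,0,1,4), (0,0,2,5)],
    [(4,1,0,2), (2,1,1,3), (3,1,3,0)], [(0,1,1,5), (1,1,3,2), (0,1,6,0)], [(0,1,3,3), (2,1,2,2)],
    [(1,3,0,3), (0,3,3,1), (2,3,2,0)], [(0,0,4,3), (3,0,0,4), (4,0,2,1)], [(4,1,0,2), (0,1,2,4),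
    (3,1,3,0), (1,1,4,1)], [(3,2,2,0), (1,2,3,1), (0,6,0,1)], [(0,0,4,3), (0,4,3,0), (6,0,1,0),
    (1,0,1,5), (1,4,0,2)], [(0,2,4,1), (3,2,0,2), (1,6,0,0), (1,2,1,3)], [(2,0,0,5), (0,0,6,1)],
    [(0,3,3,1)], [(0,4,1,2), (2,0,1,4), (4,0,0,3), (2,4,0,1)], [(1,1,0,5), (0,1,3,3), (6,1,0,0)],
    [(3,2,1,1), (1,2,2,2), (5,2,0,0)], [(4,0,0,3), (5,0,2,0), (2,0,1,4)], [(4,3,0,0), (0,3,2,2)],
    [(0,0,3,4), (4,0,1,2), (1,0,0,6)]]"];
      code_simp)

lemma attained_7_22_9: "attained TYPE('k::field_char_0) 7 22 9 220"
  by (rule attained_from_blocks[where e = 2 and m = 11 and W = "(0,10,6,8)" and fs = "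
    [[(4,3,0,0), (0,2,4,1)], [(1,0,3,3), (0,4,0,3)], [(0,3,4,0)], [(2,2,3,0), (0,4,2,1),
    (2,0,1,4)], [(1,1,1,4), (1,3,3,0), (1,0,0,6), (3,0,3,1), (0,0,4,3)], [(3,2,0,2), (5,0,1,1),
    (1,5,0,1), (0,4,3,0), (0,1,0,6)], [(0,0,6,1), (0,5,0,2)], [(2,0,0,5), (2,2,2,1), (1,0,4,2),
    (1,1,5,0)], [(1,0,6,0), (3,2,0,2), (0,2,1,4), (0,3,2,2)], [(0,1,3,3), (3,1,2,1), (6,0,0,1),
    (0,2,4,1)], [(0,0,5,2), (0,6,0,1), (1,0,1,5), (4,0,0,3)], [(0,3,0,4), (0,4,1,2), (4,0,3,0),
    (2,1,1,3), (1,1,5,0)], [(2,4,1,0), (0,1,6,0), (0,0,5,2)], [(0,1,4,2), (2,5,0,0), (0,0,3,4),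
    (6,0,1,0)], [(0,3,1,3), (3,3,0,1), (5,1,1,0)], [(2,0,3,2), (2,1,4,0), (0,2,2,3), (1,5,1,0)],
    [(3,1,1,2)], [(0,0,3,4), (1,1,0,5)]]"];
      code_simp)

lemma attained_7_14_10: "attained TYPE('k::field_char_0) 7 14 10 280"
  by (rule attained_from_blocks[where e = 3 and m = 15 and W = "(0,1,2,14)" and fs = "
    [[(3,3,1,0), (0,6,0,1)], [(5,1,0,1), (3,2,0,2), (1,3,0,3)], [(5,1,1,0), (0,5,0,2), (1,0,3,3)],
    [(2,0,0,5), (0,1,0,6), (2,0,5,0), (1,2,4,0)], [(4,0,0,3), (0,2,0,5), (1,0,6,0)], [(2,3,0,2),
    (6,1,0,0), (2,0,2,3)], [(2,1,4,0), (0,2,4,1), (1,0,5,1), (1,3,3,0), (0,5,2,0)], [(2,5,0,0),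
    (0,0,4,3), (4,1,2,0), (3,0,3,1)], [(2,3,1,1), (2,0,3,2), (0,4,1,2), (5,0,2,0)], [(0,3,4,0),
    (0,0,1,6), (1,1,0,5), (0,0,6,1)]]"];
      code_simp)

lemma attained_7_15_10: "attained TYPE('k::field_char_0) 7 15 10 286"
  by (rule attained_from_blocks[where e = 3 and m = 20 and W = "(0,7,8,16)" and fs = "
    [[(5,1,0,1), (1,5,1,0), (2,1,1,3)], [(3,0,2,2), (6,0,1,0)], [(0,2,0,5), (2,2,1,2), (5,2,0,0),
    (1,2,3,1)], [(0,5,1,1), (0,1,3,3), (1,1,1,4)], [(1,2,0,4), (3,2,1,1), (0,6,0,1)], [(1,4,2,0),
    (2,0,2,3), (4,0,3,0), (1,0,4,2), (0,0,6,1), (0,0,1,6)], [(1,1,5,0), (0,1,2,4), (3,1,1,2),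
    (6,1,0,0)], [(3,0,0,4), (1,4,2,0), (1,0,4,2), (2,4,0,1), (0,0,1,6)], [(2,3,0,2), (0,3,4,0)],
    [(1,0,3,3), (0,0,5,2)], [(1,0,6,0), (3,4,0,0), (2,0,4,1), (6,0,1,0)]]"];
      code_simp)

lemma attained_7_10_11: "attained TYPE('k::field_char_0) 7 10 11 350"
  by (rule attained_from_blocks[where e = 4 and m = 18 and W = "(0,14,15,11)" and fs = "
    [[(0,1,5,1), (5,2,0,0), (0,5,2,0)], [(3,0,1,3), (1,6,0,0), (5,0,2,0), (0,3,4,0)], [(2,0,0,5),
    (2,2,3,0), (4,0,1,2)], [(2,0,5,0), (0,4,1,2), (1,3,0,3), (3,3,1,0)], [(3,2,0,2), (6,1,0,0),
    (1,0,5,1), (2,3,1,1)], [(1,1,4,1), (2,0,3,2), (0,0,2,5), (1,5,1,0), (2,4,0,1)]]"];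
      code_simp)

lemma attained_7_11_11: "attained TYPE('k::field_char_0) 7 11 11 364"
  by (rule attained_from_blocks[where e = 4 and m = 16 and W = "(0,1,4,13)" and fs = "
    [[(0,0,1,6), (0,4,1,2), (1,5,0,1)], [(2,0,0,5), (5,0,1,1), (2,4,0,1), (6,1,0,0)], [(0,2,0,5),
    (0,3,4,0)], [(2,2,0,3), (0,4,2,1), (1,5,1,0), (3,0,3,1)], [(1,5,0,1), (4,1,1,1), (0,1,5,1)],
    [(3,3,0,1), (1,1,2,3), (3,0,4,0), (0,0,3,4)], [(2,0,3,2), (1,6,0,0), (4,2,1,0)]]"];
      code_simp)

lemma attained_7_8_12: "attained TYPE('k::field_char_0) 7 8 12 448"
  by (rule attained_from_blocks[where e = 5 and m = 11 and W = "(0,4,10,2)" and fs = "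
    [[(1,1,5,0), (0,5,1,1), (2,3,2,0), (6,0,1,0)], [(6,0,0,1), (3,0,2,2), (4,1,2,0), (1,6,0,0),
    (0,5,0,2)], [(1,0,0,6), (5,0,1,1), (0,1,5,1), (2,1,0,4), (4,3,0,0)], [(1,0,6,0), (0,4,2,1),
    (0,0,3,4), (2,2,3,0), (2,3,0,2), (0,1,0,6), (3,4,0,0)]]"];
      code_simp)

lemma attained_7_9_12: "attained TYPE('k::field_char_0) 7 9 12 455"
  by (rule attained_from_blocks[where e = 5 and m = 24 and W = "(0,23,19,5)" and fs = "
    [[(2,4,1,0), (0,0,2,5)], [(1,3,0,3), (1,2,3,1)], [(0,4,2,1), (4,0,0,3), (0,0,2,5)],
    [(0,6,0,1), (6,1,0,0), (0,2,0,5), (2,0,5,0), (4,1,1,1)], [(4,1,0,2), (0,5,2,0), (0,0,5,2),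
    (4,0,3,0), (2,1,1,3)]]"];
      code_simp)

lemma attained_7_6_13: "attained TYPE('k::field_char_0) 7 6 13 504"
  by (rule attained_from_blocks[where e = 6 and m = 18 and W = "(0,4,7,17)" and fs = "
    [[(2,0,5,0), (1,3,1,2), (1,1,0,5), (0,0,3,4)], [(0,5,2,0), (5,0,0,2), (2,1,2,2)]]"];
      code_simp)

lemma attained_7_7_13: "attained TYPE('k::field_char_0) 7 7 13 560"
  by (rule attained_from_blocks[where e = 6 and m = 13 and W = "(0,6,11,10)" and fs = "
    [[(4,0,3,0), (0,1,6,0), (0,6,0,1), (0,3,1,3)], [(3,1,0,3), (1,6,0,0), (0,0,5,2)], [(3,4,0,0),
    (2,0,0,5), (0,0,6,1), (0,5,0,2), (0,2,1,4), (1,3,2,1)]]"];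
      code_simp)

lemma attained_7_6_14: "attained TYPE('k::field_char_0) 7 6 14 680"
  by (rule attained_from_blocks[where e = 7 and m = 16 and W = "(0,7,13,15)" and fs = "
    [[(0,6,0,1), (2,4,1,0), (0,2,0,5), (0,3,4,0), (2,0,1,4)], [(6,0,1,0), (0,3,2,2), (2,1,3,1),
    (0,0,6,1), (4,0,0,3)]]"];
      code_simp)

lemma attained_7_5_14: "attained TYPE('k::field_char_0) 7 5 14 590"
  by (rule attained_from_blocks[where e = 7 and m = 18 and W = "(0,8,7,3)" and fs = "
    [[(0,4,3,0), (3,1,0,3), (2,0,5,0)]]"];
      code_simp)

lemma attained_7_5_15: "attained TYPE('k::field_char_0) 7 5 15 785"
  by (rule attained_from_blocks[where e = 8 and m = 13 and W = "(0,4,12,3)" and fs = "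
    [[(0,3,3,1), (6,0,1,0), (1,2,2,2), (3,0,0,4), (4,3,0,0)]]"];
      code_simp)

lemma attained_7_5_16: "attained TYPE('k::field_char_0) 7 5 16 969"
  by (rule attained_from_blocks[where e = 9 and m = 15 and W = "(0,3,14,2)" and fs = "
    [[(3,0,3,1), (0,3,1,3), (1,2,0,4), (1,5,1,0), (6,0,1,0)]]"];
      code_simp)

section \<open>Conclusion\<close>

lemma num_monomials_values:
  "num_monomials 0 = 1" "num_monomials (Suc 0) = 4" "num_monomials 2 = 10" "num_monomials 3 = 20"
  "num_monomials 4 = 35" "num_monomials 5 = 56" "num_monomials 6 = 84" "num_monomials 7 = 120"
  "num_monomials 8 = 165" "num_monomials 9 = 220" "num_monomials 10 = 286" "num_monomials 11 = 364"
  "num_monomials 12 = 455" "num_monomials 13 = 560" "num_monomials 14 = 680"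
  by code_simp+

text \<open>The cases are ranges of \<open>r\<close> on which one degree serves as the first with a nonpositive
  coefficient: \<open>11\<close> for \<open>r = 5\<close>, then \<open>10, 9, \<dots>, 5\<close> as \<open>r\<close> grows.\<close>

lemma froeberg_generic_degree_5:
  "generic 5 r (froeberg 5 r :: (nat \<Rightarrow> (4, 'k::field_char_0) mpoly) \<Rightarrow> bool)"
proof -
  consider "r \<le> 4" | "r = 5" | "r = 6" | "7 \<le> r" "r \<le> 8" | "9 \<le> r" "r \<le> 11" | "12 \<le> r" "r \<le> 20"
    | "21 \<le> r" "r \<le> 55" | "56 \<le> r" by linarith
  then show ?thesis
  proof cases
    case 1
    then show ?thesis by (rule froeberg_generic_at_most_4[rotated]) simp
  next
    case 2
    have "generic 5 5 (froeberg 5 5 :: (nat \<Rightarrow> (4, 'k) mpoly) \<Rightarrow> bool)"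
    proof (rule froeberg_generic_5_from_rank[where r = 6 and N = 11])
      show "attained TYPE('k) 5 6 (5 + (5 - 1)) (6 * num_monomials (5 - 1))"
        using attained_5_6_9[where 'k = 'k] by (simp add: num_monomials_values)
      show "expected 5 5 11 \<le> 0" by code_simp
      fix j :: nat assume "j \<in> {2 * 5..11}"
      then have "j = 10 \<or> j = 11" by auto
      moreover have "nat (int (num_monomials 10) - max 0 (expected 5 5 10)) = 270"
        "nat (int (num_monomials 11) - max 0 (expected 5 5 11)) = 364"
        by code_simp+
      ultimately show "attained TYPE('k) 5 5 j (nat (int (num_monomials j) - max 0 (expected 5 5
          j)))"
        using attained_5_5_10[where 'k = 'k] attained_5_5_11[where 'k = 'k] by (elim disjE) simp_all
    qed simp_all
    then show ?thesis using 2 by simp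
  next
    case 3
    have neg: "expected 5 6 10 \<le> 0" by code_simp
    show ?thesis
      by (rule froeberg_generic_between[where e = 5 and ?r1.0 = 6 and ?r2.0 = 6])
        (use 3 neg attained_5_6_9[where 'k = 'k] attained_5_6_10[where 'k = 'k] in \<open>simp_all add:
            num_monomials_values\<close>)
  next
    case 4
    show ?thesis
      by (rule froeberg_generic_linear[where e = 4 and ?r1.0 = 8 and ?r2.0 = 7])
        (use 4 attained_5_8_8[where 'k = 'k] attained_5_7_9[where 'k = 'k] in \<open>simp_all add:
            num_monomials_values\<close>)
  next
    case 5
    show ?thesis
      by (rule froeberg_generic_linear[where e = 3 and ?r1.0 = 12 and ?r2.0 = 9])
        (use 5 attained_5_12_7[where 'k = 'k] attained_5_9_8[where 'k = 'k] in \<open>simp_all add: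
            num_monomials_values\<close>)
  next
    case 6
    show ?thesis
      by (rule froeberg_generic_linear[where e = 2 and ?r1.0 = 21 and ?r2.0 = 12])
        (use 6 attained_5_21_6[where 'k = 'k] attained_5_12_7[where 'k = 'k] in \<open>simp_all add:
            num_monomials_values\<close>)
  next
    case 7
    show ?thesis
      by (rule froeberg_generic_linear[where e = 1 and ?r1.0 = 56 and ?r2.0 = 21])
        (use 7 attained_spanning[of 5 56, where 'k = 'k] attained_5_21_6[where 'k = 'k] in
            \<open>simp_all add: num_monomials_values\<close>)
  next
    case 8
    show ?thesis
      by (rule froeberg_generic_linear[where e = 0 and ?r2.0 = 56])
        (use 8 attained_spanning[of 5 56, where 'k = 'k] in \<open>simp_all add: num_monomials_values\<close>)
  qed
qed

text \<open>Here the degrees are \<open>16\<close> for \<open>r = 5\<close>, then \<open>14, 13, \<dots>, 7\<close>.\<close>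

lemma froeberg_generic_degree_7:
  "generic 7 r (froeberg 7 r :: (nat \<Rightarrow> (4, 'k::field_char_0) mpoly) \<Rightarrow> bool)"
proof -
  consider "r \<le> 4" | "r = 5" | "r = 6" | "7 \<le> r" "r \<le> 8" | "9 \<le> r" "r \<le> 10" | "11 \<le> r" "r \<le> 14"
    | "15 \<le> r" "r \<le> 21" | "22 \<le> r" "r \<le> 41" | "42 \<le> r" "r \<le> 119" | "120 \<le> r" by linarith
  then show ?thesis
  proof cases
    case 1
    then show ?thesis by (rule froeberg_generic_at_most_4[rotated]) simp
  next
    case 2
    have "generic 7 5 (froeberg 7 5 :: (nat \<Rightarrow> (4, 'k) mpoly) \<Rightarrow> bool)"
    proof (rule froeberg_generic_5_from_rank[where r = 6 and N = 16])
      show "attained TYPE('k) 7 6 (7 + (7 - 1)) (6 * num_monomials (7 - 1))"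
        using attained_7_6_13[where 'k = 'k] by (simp add: num_monomials_values)
      show "expected 7 5 16 \<le> 0" by code_simp
      fix j :: nat assume "j \<in> {2 * 7..16}"
      then have "j = 14 \<or> j = 15 \<or> j = 16" by auto
      moreover have "nat (int (num_monomials 14) - max 0 (expected 7 5 14)) = 590"
        "nat (int (num_monomials 15) - max 0 (expected 7 5 15)) = 785"
        "nat (int (num_monomials 16) - max 0 (expected 7 5 16)) = 969"
        by code_simp+
      ultimately show "attained TYPE('k) 7 5 j (nat (int (num_monomials j) - max 0 (expected 7 5
          j)))"
        using attained_7_5_14[where 'k = 'k] attained_7_5_15[where 'k = 'k] attained_7_5_16[where
            'k = 'k] by (elim disjE) simp_all
    qed simp_all
    then show ?thesis using 2 by simp
  next
    case 3
    have neg: "expected 7 6 14 \<le> 0" by code_simp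
    show ?thesis
      by (rule froeberg_generic_between[where e = 7 and ?r1.0 = 6 and ?r2.0 = 6])
        (use 3 neg attained_7_6_13[where 'k = 'k] attained_7_6_14[where 'k = 'k] in \<open>simp_all add:
            num_monomials_values\<close>)
  next
    case 4
    show ?thesis
      by (rule froeberg_generic_linear[where e = 6 and ?r1.0 = 8 and ?r2.0 = 7])
        (use 4 attained_7_8_12[where 'k = 'k] attained_7_7_13[where 'k = 'k] in \<open>simp_all add:
            num_monomials_values\<close>)
  next
    case 5
    show ?thesis
      by (rule froeberg_generic_linear[where e = 5 and ?r1.0 = 10 and ?r2.0 = 9])
        (use 5 attained_7_10_11[where 'k = 'k] attained_7_9_12[where 'k = 'k] in \<open>simp_all add:
            num_monomials_values\<close>)
  next
    case 6
    show ?thesis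
      by (rule froeberg_generic_linear[where e = 4 and ?r1.0 = 14 and ?r2.0 = 11])
        (use 6 attained_7_14_10[where 'k = 'k] attained_7_11_11[where 'k = 'k] in \<open>simp_all add:
            num_monomials_values\<close>)
  next
    case 7
    show ?thesis
      by (rule froeberg_generic_linear[where e = 3 and ?r1.0 = 22 and ?r2.0 = 15])
        (use 7 attained_7_22_9[where 'k = 'k] attained_7_15_10[where 'k = 'k] in \<open>simp_all add:
            num_monomials_values\<close>)
  next
    case 8
    show ?thesis
      by (rule froeberg_generic_linear[where e = 2 and ?r1.0 = 41 and ?r2.0 = 22])
        (use 8 attained_7_41_8[where 'k = 'k] attained_7_22_9[where 'k = 'k] in \<open>simp_all add:
            num_monomials_values\<close>)
  next
    case 9
    show ?thesis
      by (rule froeberg_generic_linear[where e = 1 and ?r1.0 = 120 and ?r2.0 = 42])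
        (use 9 attained_spanning[of 7 120, where 'k = 'k] attained_7_42_8[where 'k = 'k] in
            \<open>simp_all add: num_monomials_values\<close>)
  next
    case 10
    show ?thesis
      by (rule froeberg_generic_linear[where e = 0 and ?r2.0 = 120])
        (use 10 attained_spanning[of 7 120, where 'k = 'k] in \<open>simp_all add: num_monomials_values\<close>)
  qed
qed

theorem theorem1p1:
  fixes d r :: nat
  assumes "d \<in> {5, 7}" and "r \<ge> 1"
  shows "\<exists>U :: (nat \<Rightarrow> (4, 'k::field_char_0) mpoly) set.
    zariski_open d r U \<and> U \<noteq> {} \<and>
    (\<forall>F\<in>U. hilbert_series (ideal_of (F ` {1..r})) =
       positive_truncation ((1 - fps_X ^ d) ^ r / (1 - fps_X) ^ 4))"
proof -
  have "generic d r (froeberg d r :: (nat \<Rightarrow> (4, 'k) mpoly) \<Rightarrow> bool)"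
    using assms(1) froeberg_generic_degree_5 froeberg_generic_degree_7 by auto
  then obtain U :: "(nat \<Rightarrow> (4, 'k) mpoly) set" where U: "zariski_open d r U" "U \<noteq> {}"
      "\<forall>F\<in>U. F \<in> form_tuples d r \<and> froeberg d r F"
    using generic_open by blast
  have "d > 0" using assms(1) by auto
  then have "hilbert_series (ideal_of (F ` {1..r})) =
      positive_truncation ((1 - fps_X ^ d) ^ r / (1 - fps_X) ^ 4)" if "F \<in> U" for F
    using U(3) that by (intro hilbert_series_if_froeberg) auto
  then show ?thesis using U(1,2) by blast
qed

end
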